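(* Let $\mathbb{K}$ be an algebraically closed field of characteristic zero and let $D$ be a simple derivation of $\mathbb{K}[x,y]$. Then $\mathrm{Aut}(D)=\{\mathrm{id}\}$.
   Context: A derivation of $\mathbb{K}[x,y]$ is a $\mathbb{K}$-linear map $D:\mathbb{K}[x,y]\to\mathbb{K}[x,y]$ with $D(fg)=gD(f)+fD(g)$. $D$ is simple if it does not stabilize any nontrivial ideal, i.e. there is no ideal $I$ with $(0)\neq I\neq \mathbb{K}[x,y]$ and $D(I)\subseteq I$. $\mathrm{Aut}(D)$ denotes the group of $\mathbb{K}$-algebra automorphisms $\rho$ of $\mathbb{K}[x,y]$ with $\rho D=D\rho$. *)

theory Defs
  imports "HOL-Computational_Algebra.Polynomial"
begin

text \<open>The polynomial ring K[x,y] is represented as K[x][y], i.e. the type 'a poly poly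
  (inner variable x, outer variable y). The constant c of K is [:[:c:]:].\<close>

type_synonym 'a bipoly = "'a poly poly"

definition bconst :: "'a::zero \<Rightarrow> 'a bipoly" where
  "bconst c = [:[:c:]:]"

definition is_derivation :: "('a::field bipoly \<Rightarrow> 'a bipoly) \<Rightarrow> bool" where
  "is_derivation D \<longleftrightarrow>
     (\<forall>f g. D (f + g) = D f + D g) \<and>
     (\<forall>c f. D (bconst c * f) = bconst c * D f) \<and>
     (\<forall>f g. D (f * g) = g * D f + f * D g)"

definition is_ideal :: "'a::comm_ring_1 set \<Rightarrow> bool" where
  "is_ideal I \<longleftrightarrow> 0 \<in> I \<and> (\<forall>a\<in>I. \<forall>b\<in>I. a + b \<in> I) \<and> (\<forall>r. \<forall>a\<in>I. r * a \<in> I)"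

definition simple_derivation :: "('a::field bipoly \<Rightarrow> 'a bipoly) \<Rightarrow> bool" where
  "simple_derivation D \<longleftrightarrow> is_derivation D \<and>
     \<not> (\<exists>I. is_ideal I \<and> I \<noteq> {0} \<and> I \<noteq> UNIV \<and> D ` I \<subseteq> I)"

definition is_K_algebra_aut :: "('a::field bipoly \<Rightarrow> 'a bipoly) \<Rightarrow> bool" where
  "is_K_algebra_aut \<rho> \<longleftrightarrow> bij \<rho> \<and>
     (\<forall>f g. \<rho> (f + g) = \<rho> f + \<rho> g) \<and>
     (\<forall>f g. \<rho> (f * g) = \<rho> f * \<rho> g) \<and>
     (\<forall>c. \<rho> (bconst c) = bconst c)"

definition Aut_der :: "('a::field bipoly \<Rightarrow> 'a bipoly) \<Rightarrow> ('a bipoly \<Rightarrow> 'a bipoly) set" where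
  "Aut_der D = {\<rho>. is_K_algebra_aut \<rho> \<and> \<rho> \<circ> D = D \<circ> \<rho>}"

end

theory Submission
  imports Defs
begin

text \<open>
  Let \<open>\<rho>\<close> be an automorphism that commutes with the simple derivation \<open>D\<close>. The ideal generated by all
  \<open>\<rho> h - h\<close>, which defines the fixed points of \<open>\<rho>\<close>, is \<open>D\<close>-stable, hence \<open>\<rho> = id\<close> or this ideal is
  the whole ring.

  By Jung's theorem the automorphism group is generated by triangular automorphisms and the swap.
  (If \<open>f, g\<close> are the components of an automorphism, of degrees \<open>m, n\<close>, then \<open>P(f, g) = x\<close> for some \<open>P\<close>.
  Take \<open>q\<close> derivatives of \<open>P\<close> in the second variable until its leading part no longer vanishes at the
  leading forms of \<open>f\<close> and \<open>g\<close>; here \<open>q\<close> is small, since the order of a nonzero root is less than the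
  number of terms. Bounding degrees by the Jacobian yields \<open>lcm m n < m + n\<close> or \<open>q = 0\<close>. So one degree
  divides the other, and the leading forms are proportional after taking a power.) Cyclic reduction of
  words then shows that \<open>\<rho>\<close> is conjugate to a triangular automorphism or to a composition of
  generalised Henon maps of degrees at least two.

  In the second case the equations of the fixed points have leading forms without a common zero, so they
  do not generate the unit ideal. In the first case \<open>\<rho>\<close> has a fixed point, or \<open>D\<close> stabilises a line that
  is invariant under \<open>\<rho>\<close>, or, in suitable coordinates, \<open>D x\<close> and \<open>D y\<close> depend on a single variable, so
  that \<open>D\<close> stabilises a principal ideal.
\<close>

section \<open>Univariate polynomials\<close>

lemma coeff_mult_top:
  fixes p q :: "'a::comm_semiring_0 poly"
  assumes "degree p \<le> m" "degree q \<le> n"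
  shows "coeff (p * q) (m + n) = coeff p m * coeff q n"
proof (cases "degree p = m \<and> degree q = n")
  case True
  then show ?thesis using coeff_mult_degree_sum[of p q] by simp
next
  case False
  then have "degree (p * q) < m + n"
    using assms degree_mult_le[of p q] by linarith
  then show ?thesis using False assms by (auto simp: coeff_eq_0)
qed

lemma coeff_power_top:
  fixes p :: "'a::comm_semiring_1 poly"
  assumes "degree p \<le> m"
  shows "degree (p ^ n) \<le> m * n" "coeff (p ^ n) (m * n) = coeff p m ^ n"
proof -
  show deg: "degree (p ^ n) \<le> m * n" for n
    using degree_power_le[of p n] assms by (meson dual_order.trans mult_le_mono1)
  show "coeff (p ^ n) (m * n) = coeff p m ^ n"
    by (induction n) (auto simp: coeff_mult_top[OF assms deg])
qed

lemma const_poly_power: "[:c :: 'a::comm_semiring_1:] ^ n = [:c ^ n:]"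
  by (induction n) (simp_all add: one_pCons mult.commute)

lemma map_poly_hom:
  fixes h :: "'a::comm_semiring_0 \<Rightarrow> 'b::comm_semiring_0"
  assumes zero: "h 0 = 0" and add: "\<And>a b. h (a + b) = h a + h b" and mult: "\<And>a b. h (a * b) = h a * h b"
  shows "map_poly h (p + q) = map_poly h p + map_poly h q"
    and "map_poly h (p * q) = map_poly h p * map_poly h q"
proof -
  show add': "map_poly h (p + q) = map_poly h p + map_poly h q" for p q
    by (rule poly_eqI) (simp add: coeff_map_poly zero add)
  show "map_poly h (p * q) = map_poly h p * map_poly h q"
    by (induction p) (simp_all add: zero add' map_poly_pCons map_poly_smult mult)
qed

lemma ex_division_unit_lead_coeff:
  fixes f g :: "'a::idom poly"
  assumes "lead_coeff g dvd 1"
  obtains q r where "f = g * q + r" "r = 0 \<or> degree r < degree g"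
proof -
  obtain k where k: "lead_coeff g * k = 1" using assms by (metis dvdE)
  then have "g \<noteq> 0" by auto
  obtain q r where "pseudo_divmod f g = (q, r)" by fastforce
  note qr = pseudo_divmod[OF \<open>g \<noteq> 0\<close> this]
  define N where "N = Suc (degree f) - degree g"
  have "k ^ N * lead_coeff g ^ N = 1"
    using k by (metis mult.commute power_mult_distrib power_one)
  then have "f = smult (k ^ N) (smult (lead_coeff g ^ N) f)" by simp
  also have "\<dots> = g * smult (k ^ N) q + smult (k ^ N) r"
    unfolding qr(1)[folded N_def] by (simp add: smult_add_right)
  finally show ?thesis
    by (rule that) (use qr(2) degree_smult_le[of "k ^ N" r] in auto)
qed

lemma surj_poly_operatorI:
  fixes \<Delta> :: "'a::field poly \<Rightarrow> 'a poly"
  assumes add: "\<And>s t. \<Delta> (s + t) = \<Delta> s + \<Delta> t" and smult: "\<And>c s. \<Delta> (smult c s) = smult c (\<Delta> s)"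
    and degrees: "\<And>n. \<exists>s. degree (\<Delta> s) \<le> n \<and> coeff (\<Delta> s) n \<noteq> 0"
  shows "surj \<Delta>"
proof -
  have "\<exists>s. \<Delta> s = p" if "\<And>i. i \<ge> n \<Longrightarrow> coeff p i = 0" for n p
    using that
  proof (induction n arbitrary: p)
    case 0
    then have "p = 0" by (intro poly_eqI) auto
    then show ?case using smult[of 0 0] by (intro exI[of _ 0]) simp
  next
    case (Suc n)
    obtain s where s: "degree (\<Delta> s) \<le> n" "coeff (\<Delta> s) n \<noteq> 0" using degrees by blast
    define s' where "s' = smult (coeff p n / coeff (\<Delta> s) n) s"
    have "coeff (p - \<Delta> s') i = 0" if "i \<ge> n" for i
      using s Suc.prems[of i] that by (cases "i = n") (auto simp: s'_def smult coeff_eq_0)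
    then obtain t where "\<Delta> t = p - \<Delta> s'" using Suc.IH by blast
    then have "\<Delta> (t + s') = p" by (simp add: add)
    then show ?case by blast
  qed
  then have "\<exists>s. \<Delta> s = p" for p by (metis coeff_eq_0 less_eq_Suc_le)
  then show ?thesis by (metis surjI)
qed

lemma surj_pderiv: "surj (pderiv :: 'a::field_char_0 poly \<Rightarrow> 'a poly)"
proof (rule surj_poly_operatorI)
  show "\<exists>s :: 'a poly. degree (pderiv s) \<le> n \<and> coeff (pderiv s) n \<noteq> 0" for n
    by (rule exI[of _ "monom 1 (Suc n)"]) (simp add: pderiv_monom degree_monom_le del: of_nat_Suc)
qed (simp_all add: pderiv_add pderiv_smult)

lemma pcompose_monom: "pcompose (monom c n) q = smult c (q ^ n)"
  by (induction n) (simp_all add: monom_0 monom_Suc pcompose_pCons)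

lemma surj_scaled_difference:
  fixes d g :: "'a::field_char_0"
  assumes "g \<noteq> 0"
  shows "surj (\<lambda>s. pcompose s [:g, 1:] - smult d s)"
proof (rule surj_poly_operatorI)
  fix n
  let ?\<Delta> = "\<lambda>s. pcompose s [:g, 1:] - smult d s"
  have deg: "degree ([:g, 1:] ^ k) = k" for k by (simp add: degree_power_eq)
  show "\<exists>s. degree (?\<Delta> s) \<le> n \<and> coeff (?\<Delta> s) n \<noteq> 0"
  proof (cases "d = 1")
    case False
    have "degree (?\<Delta> (monom 1 n)) \<le> n"
      unfolding pcompose_monom
      by (intro degree_diff_le) (auto intro: order.trans[OF degree_smult_le] simp: deg degree_monom_le)
    moreover have "coeff (?\<Delta> (monom 1 n)) n \<noteq> 0"
      using False by (simp add: pcompose_monom coeff_linear_power)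
    ultimately show ?thesis by blast
  next
    case True
    have "coeff (?\<Delta> (monom 1 (Suc n))) i = 0" if "i > n" for i
      using that deg[of "Suc n"] True coeff_linear_power[of g "Suc n"]
      by (cases "i = Suc n") (simp_all add: pcompose_monom coeff_eq_0 del: power_Suc)
    then have "degree (?\<Delta> (monom 1 (Suc n))) \<le> n" by (intro degree_le) auto
    moreover have "coeff (?\<Delta> (monom 1 (Suc n))) n \<noteq> 0"
      using assms by (simp add: pcompose_monom coeff_linear_poly_power del: power_Suc of_nat_Suc)
    ultimately show ?thesis by blast
  qed
qed (simp_all add: pcompose_add pcompose_smult smult_add_right smult_diff_right mult.commute)

lemma shift_invariant_imp_const:
  fixes q :: "'a::{idom,ring_char_0} poly"
  assumes q: "pcompose q [:g, 1:] = q" and "g \<noteq> 0"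
  shows "degree q = 0"
proof -
  have shift: "poly q (g + x) = poly q x" for x
    by (subst q[symmetric]) (simp add: poly_pcompose)
  have "poly q (of_nat n * g) = poly q 0" for n
  proof (induction n)
    case (Suc n)
    then show ?case using shift[of "of_nat n * g"] by (simp add: algebra_simps)
  qed simp
  then have "range (\<lambda>n. of_nat n * g) \<subseteq> {x. poly (q - [:poly q 0:]) x = 0}" by auto
  moreover have "infinite (range (\<lambda>n. of_nat n * g))"
    using \<open>g \<noteq> 0\<close> by (intro range_inj_infinite) (auto simp: inj_on_def)
  ultimately have "q - [:poly q 0:] = 0"
    using poly_roots_finite finite_subset by blast
  then show ?thesis by (metis degree_pCons_0 eq_iff_diff_eq_0)
qed

lemma lead_coeff_shift:
  fixes q :: "'a::idom poly"
  shows "lead_coeff (pcompose q [:g, 1:]) = lead_coeff q"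
  by (subst lead_coeff_comp) simp_all

lemma shift_eigenvector_imp_const:
  fixes q :: "'a::{idom,ring_char_0} poly"
  assumes eigen: "smult c (pcompose q [:g, 1:]) = q" and "g \<noteq> 0"
  shows "degree q = 0"
proof (cases "q = 0")
  case False
  have "c * lead_coeff q = lead_coeff q"
    using eigen lead_coeff_shift[of q g] by (metis lead_coeff_smult)
  then have "c = 1" using False by simp
  then show ?thesis using eigen \<open>g \<noteq> 0\<close> by (intro shift_invariant_imp_const[of q g]) auto
qed simp

lemma wronskian_eq_0_imp_smult:
  fixes p q :: "'a::field_char_0 poly"
  assumes "p \<noteq> 0" and wronskian: "p * pderiv q = pderiv p * q"
  obtains c where "q = smult c p"
proof -
  have degree_eq: "degree r = degree p" if "r \<noteq> 0" "p * pderiv r = pderiv p * r" for r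
  proof -
    have top: "coeff (s * pderiv t) (degree s + degree t - 1)
        = of_nat (degree t) * (lead_coeff s * lead_coeff t)"
      for s t :: "'a poly"
    proof (cases "degree t")
      case 0
      then show ?thesis by (simp add: pderiv_eq_0_iff[THEN iffD2])
    next
      case (Suc n)
      then show ?thesis
        using coeff_mult_top[of s "degree s" "pderiv t" n] by (simp add: degree_pderiv coeff_pderiv)
    qed
    have "of_nat (degree r) * (lead_coeff p * lead_coeff r)
        = of_nat (degree p) * (lead_coeff p * lead_coeff r)"
      using top[of p r] top[of r p] that(2) by (simp add: mult.commute add.commute)
    then show ?thesis using that(1) \<open>p \<noteq> 0\<close> by simp
  qed
  define c where "c = lead_coeff q / lead_coeff p"
  have "q = smult c p"
  proof (rule ccontr)
    assume neq: "q \<noteq> smult c p"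
    have "degree (q - smult c p) = degree p"
      by (rule degree_eq) (use neq wronskian in \<open>simp_all add: pderiv_diff pderiv_smult algebra_simps\<close>)
    moreover have "coeff (q - smult c p) (degree p) = 0"
      using degree_eq[of q] wronskian \<open>p \<noteq> 0\<close> by (cases "q = 0") (simp_all add: c_def)
    ultimately show False using neq by (metis eq_iff_diff_eq_0 leading_coeff_0_iff)
  qed
  then show ?thesis by (rule that)
qed

lemma log_derivative_eq_imp_power:
  fixes p q :: "'a::field_char_0 poly"
  assumes "p \<noteq> 0" and eq: "p * pderiv q = of_nat k * pderiv p * q"
  obtains c where "q = smult c (p ^ k)"
proof (rule wronskian_eq_0_imp_smult)
  have power: "p * pderiv (p ^ k) = of_nat k * pderiv p * p ^ k"
    by (cases k)
       (simp_all add: pderiv_power_Suc of_nat_mult_conv_smult mult_ac del: of_nat_Suc power_Suc, simp add: mult_ac)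
  have "p * (p ^ k * pderiv q) = p ^ k * (p * pderiv q)" by (simp add: mult_ac)
  also have "\<dots> = (of_nat k * pderiv p * p ^ k) * q" unfolding eq by (simp add: mult_ac)
  also have "\<dots> = p * (pderiv (p ^ k) * q)" unfolding power[symmetric] by (rule mult.assoc)
  finally show "p ^ k * pderiv q = pderiv (p ^ k) * q" using \<open>p \<noteq> 0\<close> by simp
qed (use \<open>p \<noteq> 0\<close> in auto)

lemma pderiv_nonzero_of_root:
  fixes p :: "'a::{idom,semiring_char_0} poly"
  assumes "p \<noteq> 0" "poly p x = 0"
  shows "pderiv p \<noteq> 0"
proof
  assume "pderiv p = 0"
  then obtain c where "p = [:c:]" using pderiv_iszero by blast
  then show False using assms by simp
qed

lemma poly_higher_pderiv_order_nonzero: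
  fixes p :: "'a::{idom,semiring_char_0} poly"
  assumes "p \<noteq> 0"
  shows "poly ((pderiv ^^ order x p) p) x \<noteq> 0"
  using assms
proof (induction "order x p" arbitrary: p)
  case 0
  then show ?case by (simp add: order_root)
next
  case (Suc n)
  then have "poly p x = 0" by (metis order_root Zero_not_Suc)
  then have order: "order x p = Suc (order x (pderiv p))" using order_pderiv Suc.prems by blast
  moreover have "pderiv p \<noteq> 0" using Suc.prems \<open>poly p x = 0\<close> by (rule pderiv_nonzero_of_root)
  ultimately show ?case using Suc.hyps by (simp del: funpow.simps add: funpow_Suc_right)
qed

definition number_of_terms :: "'a::zero poly \<Rightarrow> nat" where
  "number_of_terms p = card {i. coeff p i \<noteq> 0}"

lemma finite_coeff_support: "finite {i. coeff p i \<noteq> 0}"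
  by (rule finite_subset[of _ "{..degree p}"]) (auto intro: le_degree)

lemma number_of_terms_pCons_0: "number_of_terms (pCons 0 p) = number_of_terms p"
proof -
  have "i \<in> {i. coeff (pCons 0 p) i \<noteq> 0} \<longleftrightarrow> i \<in> Suc ` {i. coeff p i \<noteq> 0}" for i
    by (cases i) auto
  then have "{i. coeff (pCons 0 p) i \<noteq> 0} = Suc ` {i. coeff p i \<noteq> 0}" by blast
  then show ?thesis by (simp add: number_of_terms_def card_image)
qed

lemma number_of_terms_pderiv:
  fixes p :: "'a::{idom,ring_char_0} poly"
  assumes "coeff p 0 \<noteq> 0"
  shows "number_of_terms p = Suc (number_of_terms (pderiv p))"
proof -
  have "i \<in> {i. coeff p i \<noteq> 0} \<longleftrightarrow> i \<in> insert 0 (Suc ` {i. coeff (pderiv p) i \<noteq> 0})" for i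
    using assms by (cases i) (auto simp: coeff_pderiv simp del: of_nat_Suc)
  then have "{i. coeff p i \<noteq> 0} = insert 0 (Suc ` {i. coeff (pderiv p) i \<noteq> 0})" by blast
  then show ?thesis by (simp add: number_of_terms_def card_image finite_coeff_support)
qed

lemma order_less_number_of_terms:
  fixes p :: "'a::{idom,ring_char_0} poly"
  assumes "p \<noteq> 0" "x \<noteq> 0"
  shows "order x p < number_of_terms p"
  using assms(1)
proof (induction "degree p" arbitrary: p rule: less_induct)
  case less
  consider (zero_root) "coeff p 0 = 0" | (no_root) "poly p x \<noteq> 0"
    | (root) "coeff p 0 \<noteq> 0" "poly p x = 0" by blast
  then show ?case
  proof cases
    case zero_root
    then obtain q where q: "p = pCons 0 q" by (cases p) auto
    have "p = [:0, 1:] * q" by (simp add: q)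
    moreover have "order x [:0, 1:] = 0" using \<open>x \<noteq> 0\<close> by (intro order_0I) simp
    ultimately have "order x p = order x q" using less.prems by (metis order_mult add_0)
    then show ?thesis using less by (auto simp: q number_of_terms_pCons_0)
  next
    case no_root
    then have "order x p = 0" by (simp add: order_0I)
    moreover have "{i. coeff p i \<noteq> 0} \<noteq> {}" using less.prems by (auto simp: poly_eq_iff)
    ultimately show ?thesis by (simp add: number_of_terms_def card_gt_0_iff finite_coeff_support)
  next
    case root
    have "pderiv p \<noteq> 0" using less.prems root(2) by (rule pderiv_nonzero_of_root)
    then have "order x (pderiv p) < number_of_terms (pderiv p)"
      by (intro less.hyps) (auto simp: degree_pderiv pderiv_eq_0_iff)
    moreover have "order x p = Suc (order x (pderiv p))" using less.prems root(2) by (rule order_pderiv)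
    ultimately show ?thesis using number_of_terms_pderiv[OF root(1)] by simp
  qed
qed

lemma order_mult_le_degree_of_congruent_exponents:
  fixes p :: "'a::{idom,ring_char_0} poly"
  assumes "p \<noteq> 0" "x \<noteq> 0" "m > 0"
    and exponents: "\<And>i j. coeff p i \<noteq> 0 \<Longrightarrow> coeff p j \<noteq> 0 \<Longrightarrow> i mod m = j mod m"
  shows "order x p * m \<le> degree p"
proof -
  have "inj_on (\<lambda>i. i div m) {i. coeff p i \<noteq> 0}"
    using exponents by (auto simp: inj_on_def) (metis div_mult_mod_eq)
  moreover have "(\<lambda>i. i div m) ` {i. coeff p i \<noteq> 0} \<subseteq> {..degree p div m}"
    by (auto intro: div_le_mono le_degree)
  ultimately have "number_of_terms p \<le> Suc (degree p div m)"
    using card_inj_on_le[of "\<lambda>i. i div m" _ "{..degree p div m}"] by (simp add: number_of_terms_def)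
  then have "order x p \<le> degree p div m" using order_less_number_of_terms[OF assms(1,2)] by simp
  then show ?thesis using \<open>m > 0\<close> by (simp add: less_eq_div_iff_mult_less_eq)
qed

lemma le_degree_of_monom_dvd_mult:
  fixes p q :: "'a::idom poly"
  assumes "monom 1 n dvd p * q" "p \<noteq> 0" "coeff q 0 \<noteq> 0"
  shows "n \<le> degree p"
proof -
  have "q \<noteq> 0" using assms(3) by auto
  then have "n \<le> order 0 (p * q)" using assms by (simp add: monom_1_dvd_iff)
  also have "\<dots> = order 0 p"
    using assms \<open>q \<noteq> 0\<close> by (simp add: order_mult order_0I poly_0_coeff_0)
  also have "\<dots> \<le> degree p" using \<open>p \<noteq> 0\<close> by (rule order_degree)
  finally show ?thesis .
qed

section \<open>Endomorphisms of the polynomial ring in two variables\<close>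

definition bX :: "'a::comm_semiring_1 bipoly" where "bX = [:[:0, 1:]:]"

definition bY :: "'a::comm_semiring_1 bipoly" where "bY = [:0, 1:]"

lemma bconst_0 [simp]: "bconst 0 = 0" and bconst_1 [simp]: "bconst 1 = 1"
  by (simp_all add: bconst_def one_pCons)

lemma bconst_add: "bconst (a + b) = bconst a + bconst b"
  and bconst_mult: "bconst (c * d) = bconst c * bconst (d :: 'a::comm_semiring_0)"
  by (simp_all add: bconst_def)

lemma bconst_eq_0_iff [simp]: "bconst a = 0 \<longleftrightarrow> a = 0"
  by (simp add: bconst_def)

lemma const_poly_pCons: "[:pCons c p:] = bconst c + bX * [:p:]"
  by (simp add: bconst_def bX_def)

lemma pCons_eq_add_bY_mult: "pCons p f = [:p:] + bY * (f :: 'a::comm_semiring_1 bipoly)"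
  by (simp add: bY_def)

lemma bipoly_induct [case_names const X Y add mult]:
  fixes f :: "'a::comm_semiring_1 bipoly"
  assumes const: "\<And>c. P (bconst c)" and X: "P bX" and Y: "P bY"
    and add: "\<And>f g. P f \<Longrightarrow> P g \<Longrightarrow> P (f + g)"
    and mult: "\<And>f g. P f \<Longrightarrow> P g \<Longrightarrow> P (f * g)"
  shows "P f"
proof (induction f)
  case 0
  then show ?case using const[of 0] by simp
next
  case (pCons p f)
  have "P [:p:]"
  proof (induction p)
    case 0
    then show ?case using const[of 0] by simp
  next
    case (pCons c p)
    then show ?case using add mult const X by (metis const_poly_pCons)
  qed
  then show ?case using add mult Y pCons by (metis pCons_eq_add_bY_mult)
qed

lemma bipoly_eq_sum:
  fixes f :: "'a::comm_semiring_1 bipoly"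
  shows "f = (\<Sum>j\<le>degree f. \<Sum>i\<le>degree (coeff f j). bconst (coeff (coeff f j) i) * bX ^ i * bY ^ j)"
proof -
  have X: "bconst c * bX ^ i = [:monom c i:]" for c :: 'a and i
    by (simp add: bconst_def bX_def const_poly_power monom_altdef)
  have "(\<Sum>i\<in>A. [:h i:]) = [:sum h A:]" for h :: "nat \<Rightarrow> 'a poly" and A
    by (induction A rule: infinite_finite_induct) auto
  then have inner: "(\<Sum>i\<le>degree p. [:monom (coeff p i) i:]) = [:p:]" for p :: "'a poly"
    by (simp add: poly_as_sum_of_monoms)
  have outer: "[:p:] * bY ^ j = monom p j" for p :: "'a poly" and j
    by (simp add: bY_def monom_altdef)
  show ?thesis
    by (simp only: X inner flip: sum_distrib_right) (simp only: outer poly_as_sum_of_monoms)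
qed

locale alg_hom =
  fixes \<rho> :: "'a::comm_ring_1 bipoly \<Rightarrow> 'a bipoly"
  assumes hom_add [simp]: "\<rho> (f + g) = \<rho> f + \<rho> g"
    and hom_mult [simp]: "\<rho> (f * g) = \<rho> f * \<rho> g"
    and hom_const [simp]: "\<rho> (bconst c) = bconst c"
begin

lemma hom_0 [simp]: "\<rho> 0 = 0" and hom_1 [simp]: "\<rho> 1 = 1"
  using hom_const[of 0] hom_const[of 1] by simp_all

lemma hom_minus [simp]: "\<rho> (- f) = - \<rho> f"
  using hom_add[of f "- f"] by (simp add: eq_neg_iff_add_eq_0 add.commute del: hom_add)

lemma hom_diff [simp]: "\<rho> (f - g) = \<rho> f - \<rho> g"
  using hom_add[of f "- g"] by (simp del: hom_add)

lemma hom_power [simp]: "\<rho> (f ^ n) = \<rho> f ^ n"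
  by (induction n) simp_all

lemma hom_sum: "\<rho> (sum f A) = (\<Sum>i\<in>A. \<rho> (f i))"
  by (induction A rule: infinite_finite_induct) simp_all

lemma hom_pCons: "\<rho> (pCons p f) = \<rho> [:p:] + \<rho> bY * \<rho> f"
  by (subst pCons_eq_add_bY_mult) (simp only: hom_add hom_mult)

lemma hom_const_poly: "\<rho> [:p:] = pcompose (map_poly (\<lambda>c. [:c:]) p) (\<rho> bX)"
proof (induction p)
  case (pCons c p)
  have "\<rho> [:pCons c p:] = bconst c + \<rho> bX * \<rho> [:p:]"
    by (simp only: const_poly_pCons hom_add hom_mult hom_const)
  then show ?case using pCons by (simp add: map_poly_pCons pcompose_pCons bconst_def)
qed simp

lemma hom_const_poly_inner:
  assumes "\<rho> bX = [:q:]"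
  shows "\<rho> [:p:] = [:pcompose p q:]"
  unfolding hom_const_poly assms
  by (induction p) (simp_all add: map_poly_pCons pcompose_pCons)

lemma hom_affine: "\<rho> [:[:c, a:], [:b:]:] = bconst c + bconst a * \<rho> bX + bconst b * \<rho> bY"
proof -
  have "[:[:c, a:], [:b:]:] = bconst c + bconst a * bX + bconst b * bY"
    by (simp add: bconst_def bX_def bY_def)
  then show ?thesis by simp
qed

lemma hom_affine_X: "\<rho> [:[:c, a:]:] = bconst c + bconst a * \<rho> bX"
  using hom_affine[of c a 0] by simp

lemma hom_eq_sum:
  "\<rho> f = (\<Sum>j\<le>degree f. \<Sum>i\<le>degree (coeff f j). bconst (coeff (coeff f j) i) * \<rho> bX ^ i * \<rho> bY ^ j)"
  by (subst (1) bipoly_eq_sum) (simp add: hom_sum)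

end

lemma alg_hom_eqI:
  assumes "alg_hom \<rho>" "alg_hom \<sigma>" "\<rho> bX = \<sigma> bX" "\<rho> bY = \<sigma> bY"
  shows "\<rho> = \<sigma>"
proof
  interpret \<rho>: alg_hom \<rho> by fact
  interpret \<sigma>: alg_hom \<sigma> by fact
  show "\<rho> f = \<sigma> f" for f
    by (induction f rule: bipoly_induct) (use assms in simp_all)
qed

lemma alg_hom_id: "alg_hom id"
  by unfold_locales simp_all

lemma alg_hom_comp:
  assumes "alg_hom \<rho>" "alg_hom \<sigma>"
  shows "alg_hom (\<rho> \<circ> \<sigma>)"
proof -
  interpret \<rho>: alg_hom \<rho> by fact
  interpret \<sigma>: alg_hom \<sigma> by fact
  show ?thesis by unfold_locales simp_all
qed

definition bsubst :: "'a::comm_ring_1 bipoly \<Rightarrow> 'a bipoly \<Rightarrow> 'a bipoly \<Rightarrow> 'a bipoly" where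
  "bsubst a b f = poly (map_poly (\<lambda>p. poly (map_poly bconst p) a) f) b"

interpretation bsubst: alg_hom "bsubst a b"
proof -
  have inner: "map_poly bconst (p + q) = map_poly bconst p + map_poly bconst q"
    "map_poly bconst (p * q) = map_poly bconst p * map_poly bconst q" for p q :: "'a poly"
    by (rule map_poly_hom; simp add: bconst_add bconst_mult)+
  have outer: "map_poly (\<lambda>p. poly (map_poly bconst p) a) (f + g)
        = map_poly (\<lambda>p. poly (map_poly bconst p) a) f + map_poly (\<lambda>p. poly (map_poly bconst p) a) g"
      "map_poly (\<lambda>p. poly (map_poly bconst p) a) (f * g)
        = map_poly (\<lambda>p. poly (map_poly bconst p) a) f * map_poly (\<lambda>p. poly (map_poly bconst p) a) g" for f g
    by (rule map_poly_hom; simp add: inner)+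
  show "alg_hom (bsubst a b)"
    by unfold_locales (simp_all add: bsubst_def outer, simp add: bconst_def map_poly_pCons)
qed

lemma bsubst_X [simp]: "bsubst a b bX = a" and bsubst_Y [simp]: "bsubst a b bY = b"
  by (simp_all add: bsubst_def bX_def bY_def map_poly_pCons)

lemma alg_hom_eq_bsubst: "alg_hom \<rho> \<Longrightarrow> \<rho> = bsubst (\<rho> bX) (\<rho> bY)"
  by (rule alg_hom_eqI) (simp_all add: bsubst.alg_hom_axioms)

section \<open>Automorphisms\<close>

lemma is_K_algebra_aut_iff: "is_K_algebra_aut \<rho> \<longleftrightarrow> bij \<rho> \<and> alg_hom \<rho>"
  by (auto simp: is_K_algebra_aut_def alg_hom_def)

lemma aut_alg_hom: "is_K_algebra_aut \<rho> \<Longrightarrow> alg_hom \<rho>"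
  by (simp add: is_K_algebra_aut_iff)

lemma aut_inv_apply_left: "is_K_algebra_aut \<rho> \<Longrightarrow> inv \<rho> (\<rho> f) = f"
  and aut_inv_apply_right: "is_K_algebra_aut \<rho> \<Longrightarrow> \<rho> (inv \<rho> f) = f"
  by (simp_all add: is_K_algebra_aut_iff bij_is_inj bij_is_surj surj_f_inv_f)

lemma aut_id: "is_K_algebra_aut id"
  by (simp add: is_K_algebra_aut_iff alg_hom_id)

lemma aut_comp: "is_K_algebra_aut \<rho> \<Longrightarrow> is_K_algebra_aut \<sigma> \<Longrightarrow> is_K_algebra_aut (\<rho> \<circ> \<sigma>)"
  by (simp add: is_K_algebra_aut_iff alg_hom_comp bij_comp)

lemma aut_inv:
  assumes "is_K_algebra_aut \<rho>"
  shows "is_K_algebra_aut (inv \<rho>)"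
proof -
  interpret alg_hom \<rho> using assms by (rule aut_alg_hom)
  note inv = aut_inv_apply_left[OF assms] aut_inv_apply_right[OF assms]
  have "alg_hom (inv \<rho>)"
    by unfold_locales (metis inv hom_add, metis inv hom_mult, metis inv hom_const)
  then show ?thesis using assms by (simp add: is_K_algebra_aut_iff bij_imp_bij_inv)
qed

lemma autI:
  assumes "alg_hom \<rho>" "alg_hom \<sigma>" "\<rho> \<circ> \<sigma> = id" "\<sigma> \<circ> \<rho> = id"
  shows "is_K_algebra_aut \<rho>" "inv \<rho> = \<sigma>"
  using assms o_bij[of \<sigma> \<rho>] inv_unique_comp[of \<rho> \<sigma>] by (simp_all add: is_K_algebra_aut_iff)

lemma aut_generators_not_const:
  assumes \<rho>: "is_K_algebra_aut \<rho>"
  shows "\<rho> bX \<noteq> bconst c" "\<rho> bY \<noteq> bconst c"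
proof -
  interpret inv: alg_hom "inv \<rho>" using \<rho> by (intro aut_alg_hom aut_inv)
  note inv = inv.hom_const[of c] aut_inv_apply_left[OF \<rho>]
  show "\<rho> bX \<noteq> bconst c" using inv(1) inv(2)[of bX] by (auto simp: bX_def bconst_def)
  show "\<rho> bY \<noteq> bconst c" using inv(1) inv(2)[of bY] by (auto simp: bY_def bconst_def)
qed

lemma aut_not_univariate:
  assumes \<rho>: "is_K_algebra_aut \<rho>" and X: "\<rho> bX = [:p:]"
  shows "\<rho> bY \<noteq> [:q:]"
proof
  assume Y: "\<rho> bY = [:q:]"
  interpret alg_hom \<rho> using \<rho> by (rule aut_alg_hom)
  have "\<exists>r. \<rho> f = [:r:]" for f
  proof (induction f rule: bipoly_induct)
    case (const c)
    then show ?case unfolding hom_const by (simp add: bconst_def)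
  qed (use X Y in auto)
  then obtain r where "\<rho> (inv \<rho> bY) = [:r:]" by blast
  then show False by (simp add: aut_inv_apply_right[OF \<rho>] bY_def)
qed

definition bswap :: "'a::comm_ring_1 bipoly \<Rightarrow> 'a bipoly" where
  "bswap = bsubst bY bX"

interpretation bswap: alg_hom bswap
  unfolding bswap_def by unfold_locales

lemma bswap_X [simp]: "bswap bX = bY" and bswap_Y [simp]: "bswap bY = bX"
  by (simp_all add: bswap_def)

lemma bswap_comp_bswap: "bswap \<circ> bswap = id"
  by (rule alg_hom_eqI) (simp_all add: alg_hom_comp alg_hom_id bswap.alg_hom_axioms)

lemma bswap_bswap [simp]: "bswap (bswap f) = f"
  using fun_cong[OF bswap_comp_bswap, of f] by simp

lemma aut_bswap: "is_K_algebra_aut bswap"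
  and inv_bswap: "inv (bswap :: 'a::field bipoly \<Rightarrow> 'a bipoly) = bswap"
  by (rule autI[where \<sigma> = bswap]; simp add: bswap.alg_hom_axioms bswap_comp_bswap)+

lemma coeff_bswap: "coeff (coeff (bswap f) j) i = coeff (coeff f i) j"
proof (induction f arbitrary: i)
  case (pCons p f)
  have "bswap (pCons p f) = map_poly (\<lambda>c. [:c:]) p + bX * bswap f"
    by (simp add: bswap.hom_pCons[of p f] bswap.hom_const_poly) (simp add: bY_def)
  moreover have "coeff (bX * g) j = pCons 0 (coeff g j)" for g :: "'a bipoly"
    by (simp add: bX_def)
  ultimately show ?case using pCons by (simp add: coeff_map_poly coeff_pCons split: nat.splits)
qed simp

section \<open>Derivations\<close>

lemma derivation_add: "is_derivation D \<Longrightarrow> D (f + g) = D f + D g"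
  and derivation_scale: "is_derivation D \<Longrightarrow> D (bconst c * f) = bconst c * D f"
  and derivation_mult: "is_derivation D \<Longrightarrow> D (f * g) = g * D f + f * D g"
  by (auto simp: is_derivation_def)

lemma derivation_const:
  assumes "is_derivation D"
  shows "D (bconst c) = 0"
proof -
  have "D 1 = D 1 + D 1" using derivation_mult[OF assms, of 1 1] by (metis mult_1)
  then have "D 1 = 0" by (metis add_cancel_left_left)
  then show ?thesis using derivation_scale[OF assms, of c 1] by simp
qed

lemma derivation_0: "is_derivation D \<Longrightarrow> D 0 = 0"
  using derivation_const[of D 0] by simp

lemma derivation_diff: "is_derivation D \<Longrightarrow> D (f - g) = D f - D g"
  using derivation_add[of D "f - g" g] by simp

definition inner_pderiv :: "'a::idom bipoly \<Rightarrow> 'a bipoly" where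
  "inner_pderiv = map_poly pderiv"

lemma coeff_inner_pderiv: "coeff (inner_pderiv f) n = pderiv (coeff f n)"
  by (simp add: inner_pderiv_def coeff_map_poly)

lemma inner_pderiv_X [simp]: "inner_pderiv bX = 1" and inner_pderiv_Y [simp]: "inner_pderiv bY = 0"
  and inner_pderiv_const [simp]: "inner_pderiv (bconst c) = 0"
  by (simp_all add: inner_pderiv_def bX_def bY_def bconst_def map_poly_pCons pderiv_pCons one_pCons)

lemma pderiv_X [simp]: "pderiv bX = (0 :: 'a::idom bipoly)"
  and pderiv_Y [simp]: "pderiv bY = (1 :: 'a bipoly)"
  and pderiv_const [simp]: "pderiv (bconst c) = (0 :: 'a bipoly)"
  by (simp_all add: bX_def bY_def bconst_def pderiv_pCons)

lemma inner_pderiv_add: "inner_pderiv (f + g) = inner_pderiv f + inner_pderiv g"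
  by (rule poly_eqI) (simp add: coeff_inner_pderiv pderiv_add)

lemma inner_pderiv_mult: "inner_pderiv (f * g) = f * inner_pderiv g + g * inner_pderiv f"
proof (induction f)
  case (pCons p f)
  have "inner_pderiv (smult p g) = smult p (inner_pderiv g) + smult (pderiv p) g"
    by (rule poly_eqI) (simp add: coeff_inner_pderiv pderiv_mult mult.commute)
  moreover have "inner_pderiv (pCons q h) = pCons (pderiv q) (inner_pderiv h)" for q :: "'a poly" and h
    by (simp add: inner_pderiv_def map_poly_pCons)
  ultimately show ?case
    using pCons by (simp add: inner_pderiv_add algebra_simps)
qed (simp add: inner_pderiv_def)

lemma derivation_hom_chain_rule:
  assumes d: "is_derivation d" and "alg_hom \<rho>"
  shows "d (\<rho> f) = d (\<rho> bX) * \<rho> (inner_pderiv f) + d (\<rho> bY) * \<rho> (pderiv f)"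
proof -
  interpret alg_hom \<rho> by fact
  show ?thesis
  proof (induction f rule: bipoly_induct)
    case (const c)
    then show ?case by (simp add: derivation_const[OF d])
  next
    case (add f g)
    then show ?case by (simp add: derivation_add[OF d] inner_pderiv_add pderiv_add algebra_simps)
  next
    case (mult f g)
    then show ?case by (simp add: derivation_mult[OF d] inner_pderiv_mult pderiv_mult algebra_simps)
  qed simp_all
qed

lemma derivation_const_poly:
  assumes "is_derivation d"
  shows "d [:p:] = [:pderiv p:] * d bX"
  using derivation_hom_chain_rule[OF assms alg_hom_id, of "[:p:]"]
  by (simp add: inner_pderiv_def map_poly_pCons mult.commute)

section \<open>Simple derivations\<close>

lemma is_ideal_0: "is_ideal I \<Longrightarrow> 0 \<in> I"
  and is_ideal_add: "is_ideal I \<Longrightarrow> a \<in> I \<Longrightarrow> b \<in> I \<Longrightarrow> a + b \<in> I"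
  and is_ideal_mult: "is_ideal I \<Longrightarrow> a \<in> I \<Longrightarrow> r * a \<in> I"
  and is_ideal_mult_right: "is_ideal I \<Longrightarrow> a \<in> I \<Longrightarrow> a * r \<in> I"
  by (simp_all add: is_ideal_def mult.commute[of a])

lemma is_ideal_Inter: "(\<And>I. I \<in> \<I> \<Longrightarrow> is_ideal I) \<Longrightarrow> is_ideal (\<Inter>\<I>)"
  by (simp add: is_ideal_def)

lemma is_ideal_multiples: "is_ideal {f. g dvd f}"
  by (simp add: is_ideal_def)

lemma is_ideal_two_generators: "is_ideal {u * f + v * g | u v. True}"
proof -
  have "\<exists>u v. 0 = u * f + v * g" by (rule exI[of _ 0])+ simp
  moreover have "\<exists>u'' v''. (u * f + v * g) + (u' * f + v' * g) = u'' * f + v'' * g" for u v u' v'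
    by (rule exI[of _ "u + u'"], rule exI[of _ "v + v'"]) (simp add: algebra_simps)
  moreover have "\<exists>u' v'. r * (u * f + v * g) = u' * f + v' * g" for r u v
    by (rule exI[of _ "r * u"], rule exI[of _ "r * v"]) (simp add: algebra_simps)
  ultimately show ?thesis unfolding is_ideal_def by auto
qed

lemma is_ideal_hull_generators: "is_ideal (is_ideal hull S)"
  by (rule hull_in) (simp add: is_ideal_Inter)

lemma derivation_stabilizes_ideal_hull:
  assumes D: "is_derivation D" and S: "D ` S \<subseteq> is_ideal hull S"
  shows "D ` (is_ideal hull S) \<subseteq> is_ideal hull S"
proof -
  note hull = is_ideal_hull_generators[of S]
  have "is_ideal {f \<in> is_ideal hull S. D f \<in> is_ideal hull S}"
    unfolding is_ideal_def[of "{f. _ f}"]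
    by (auto simp: derivation_0[OF D] derivation_add[OF D] derivation_mult[OF D]
        intro: is_ideal_0[OF hull] is_ideal_add[OF hull] is_ideal_mult[OF hull] is_ideal_mult_right[OF hull])
  moreover have "S \<subseteq> {f \<in> is_ideal hull S. D f \<in> is_ideal hull S}"
    using S by (auto intro: hull_inc)
  ultimately show ?thesis using hull_minimal by blast
qed

lemma simple_is_derivation: "simple_derivation D \<Longrightarrow> is_derivation D"
  by (simp add: simple_derivation_def)

lemma simple_stable_ideal:
  assumes "simple_derivation D" "is_ideal I" "D ` I \<subseteq> I" "f \<in> I" "f \<noteq> 0"
  shows "1 \<in> I"
  using assms unfolding simple_derivation_def by (metis UNIV_I singletonD)

lemma simple_semi_invariant_is_unit:
  assumes D: "simple_derivation D" and "f dvd D f" "f \<noteq> 0"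
  shows "f dvd 1"
proof -
  have "D ` {h. f dvd h} \<subseteq> {h. f dvd h}"
  proof safe
    fix h assume "f dvd h"
    then show "f dvd D h"
      using \<open>f dvd D f\<close> by (auto simp: derivation_mult[OF simple_is_derivation[OF D]] elim!: dvdE)
  qed
  then have "1 \<in> {h. f dvd h}"
    by (rule simple_stable_ideal[OF D is_ideal_multiples]) (use \<open>f \<noteq> 0\<close> in auto)
  then show ?thesis by simp
qed

lemma simple_iterates_in_ideal:
  assumes D: "simple_derivation D" and I: "is_ideal I" "1 \<notin> I" and f: "\<And>k. (D ^^ k) f \<in> I"
  shows "f = 0"
proof (rule ccontr)
  assume "f \<noteq> 0"
  note d = simple_is_derivation[OF D]
  define J where "J = {g. \<forall>k. (D ^^ k) g \<in> I}"
  have iterate_add: "(D ^^ k) (g + h) = (D ^^ k) g + (D ^^ k) h" for k g h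
    by (induction k) (simp_all add: derivation_add[OF d])
  have iterate_0: "(D ^^ k) 0 = 0" for k
    by (induction k) (simp_all add: derivation_0[OF d])
  have stable: "D g \<in> J" if "g \<in> J" for g
    using that unfolding J_def mem_Collect_eq by (metis funpow_Suc_right comp_apply)
  have "(D ^^ k) (r * g) \<in> I" if "g \<in> J" for k r g
    using that
  proof (induction k arbitrary: r g)
    case 0
    then have "g \<in> I" unfolding J_def mem_Collect_eq by (metis funpow_0)
    then show ?case using I by (simp add: is_ideal_mult)
  next
    case (Suc k)
    have "(D ^^ Suc k) (r * g) = (D ^^ k) (D r * g) + (D ^^ k) (r * D g)"
      by (simp add: funpow_swap1 derivation_mult[OF d] iterate_add mult.commute)
    then show ?case using Suc.IH Suc.prems stable I by (metis is_ideal_add)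
  qed
  then have "is_ideal J"
    using I(1) unfolding is_ideal_def[of J]
    by (simp add: J_def iterate_add iterate_0 is_ideal_0 is_ideal_add)
  moreover have "D ` J \<subseteq> J" using stable by blast
  moreover have "f \<in> J" using f by (simp add: J_def)
  ultimately have "1 \<in> J" using simple_stable_ideal[OF D] \<open>f \<noteq> 0\<close> by blast
  then show False using I unfolding J_def mem_Collect_eq by (metis funpow_0)
qed

lemma simple_coincidence_ideal:
  assumes D: "simple_derivation D" and "alg_hom \<sigma>" "alg_hom \<tau>" "\<sigma> \<noteq> \<tau>"
    and intertwine: "D \<circ> \<sigma> = \<sigma> \<circ> E" "D \<circ> \<tau> = \<tau> \<circ> E"
    and I: "is_ideal I" "\<sigma> bX - \<tau> bX \<in> I" "\<sigma> bY - \<tau> bY \<in> I"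
  shows "1 \<in> I"
proof -
  interpret \<sigma>: alg_hom \<sigma> by fact
  interpret \<tau>: alg_hom \<tau> by fact
  let ?S = "range (\<lambda>f. \<sigma> f - \<tau> f)"
  have "D (\<sigma> f - \<tau> f) = \<sigma> (E f) - \<tau> (E f)" for f
    using intertwine by (simp add: fun_eq_iff derivation_diff[OF simple_is_derivation[OF D]])
  then have "D ` ?S \<subseteq> is_ideal hull ?S" by (auto intro: hull_inc)
  then have "D ` (is_ideal hull ?S) \<subseteq> is_ideal hull ?S"
    by (rule derivation_stabilizes_ideal_hull[OF simple_is_derivation[OF D]])
  moreover obtain f where "\<sigma> f - \<tau> f \<noteq> 0" using \<open>\<sigma> \<noteq> \<tau>\<close> by auto
  moreover have "\<sigma> f - \<tau> f \<in> is_ideal hull ?S" by (simp add: hull_inc)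
  ultimately have "1 \<in> is_ideal hull ?S"
    using simple_stable_ideal[OF D is_ideal_hull_generators] by blast
  moreover have "\<sigma> f - \<tau> f \<in> I" for f
  proof (induction f rule: bipoly_induct)
    case (const c)
    then show ?case using I(1) by (simp add: is_ideal_0)
  next
    case (add f g)
    have "\<sigma> (f + g) - \<tau> (f + g) = (\<sigma> f - \<tau> f) + (\<sigma> g - \<tau> g)" by simp
    then show ?case using add I(1) by (metis is_ideal_add)
  next
    case (mult f g)
    have "\<sigma> (f * g) - \<tau> (f * g) = \<sigma> g * (\<sigma> f - \<tau> f) + \<tau> f * (\<sigma> g - \<tau> g)"
      by (simp add: algebra_simps)
    then show ?case using mult I(1) by (metis is_ideal_add is_ideal_mult)
  qed (use I in auto)
  ultimately show ?thesis using hull_minimal[of ?S I is_ideal] I(1) by blast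
qed

lemma simple_fixed_point_ideal:
  assumes "simple_derivation D" "alg_hom \<rho>" "\<rho> \<circ> D = D \<circ> \<rho>"
    and "is_ideal I" "\<rho> bX - bX \<in> I" "\<rho> bY - bY \<in> I" "1 \<notin> I"
  shows "\<rho> = id"
proof (rule ccontr)
  assume "\<rho> \<noteq> id"
  then have "1 \<in> I"
    by (rule simple_coincidence_ideal[OF assms(1,2) alg_hom_id, where E = D]) (use assms in simp_all)
  then show False using \<open>1 \<notin> I\<close> by blast
qed

lemma simple_fixed_point:
  assumes "simple_derivation D" "alg_hom \<rho>" "\<rho> \<circ> D = D \<circ> \<rho>"
    and "poly (poly (\<rho> bX) [:y:]) x = x" "poly (poly (\<rho> bY) [:y:]) x = y"
  shows "\<rho> = id"
  by (rule simple_fixed_point_ideal[OF assms(1-3), of "{f. poly (poly f [:y:]) x = 0}"])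
     (use assms in \<open>simp_all add: is_ideal_def, simp_all add: bX_def bY_def\<close>)

lemma simple_conj:
  assumes D: "simple_derivation D" and \<kappa>: "is_K_algebra_aut \<kappa>"
  shows "simple_derivation (inv \<kappa> \<circ> D \<circ> \<kappa>)"
proof -
  interpret \<kappa>: alg_hom \<kappa> using \<kappa> by (rule aut_alg_hom)
  interpret inv: alg_hom "inv \<kappa>" using \<kappa> by (intro aut_alg_hom aut_inv)
  note inv[simp] = aut_inv_apply_left[OF \<kappa>] aut_inv_apply_right[OF \<kappa>]
  note d = simple_is_derivation[OF D]
  have "is_derivation (inv \<kappa> \<circ> D \<circ> \<kappa>)"
    by (simp add: is_derivation_def derivation_add[OF d] derivation_const[OF d] derivation_mult[OF d])
  moreover have "1 \<in> I" if I: "is_ideal I" "(inv \<kappa> \<circ> D \<circ> \<kappa>) ` I \<subseteq> I" and "I \<noteq> {0}" for I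
  proof -
    have mem: "f \<in> \<kappa> ` I \<longleftrightarrow> inv \<kappa> f \<in> I" for f
      by (metis image_iff inv)
    have "is_ideal (\<kappa> ` I)"
      using I(1) by (simp add: is_ideal_def Ball_def mem)
    moreover have "D ` \<kappa> ` I \<subseteq> \<kappa> ` I"
      using I(2) by (auto simp: mem)
    moreover obtain f where "f \<in> I" "f \<noteq> 0"
      using \<open>I \<noteq> {0}\<close> I(1) by (auto simp: is_ideal_def)
    moreover from this have "\<kappa> f \<noteq> 0" by (metis inv(1) inv.hom_0)
    ultimately have "1 \<in> \<kappa> ` I" using simple_stable_ideal[OF D] by blast
    then show ?thesis by (simp add: mem)
  qed
  moreover have "I = UNIV" if "is_ideal I" "1 \<in> I" for I :: "'a bipoly set"
    using that by (metis UNIV_eq_I is_ideal_mult mult.right_neutral)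
  ultimately show ?thesis unfolding simple_derivation_def by blast
qed

lemma commute_conj:
  assumes "bij \<kappa>" "\<kappa> \<circ> \<rho>' = \<rho> \<circ> \<kappa>" "\<rho> \<circ> D = D \<circ> \<rho>"
  shows "\<rho>' \<circ> (inv \<kappa> \<circ> D \<circ> \<kappa>) = (inv \<kappa> \<circ> D \<circ> \<kappa>) \<circ> \<rho>'"
proof
  fix f
  have inv: "inv \<kappa> (\<kappa> g) = g" "\<kappa> (inv \<kappa> h) = h" for g h
    using \<open>bij \<kappa>\<close> by (simp_all add: bij_is_inj bij_is_surj surj_f_inv_f)
  have "\<kappa> (\<rho>' (inv \<kappa> (D (\<kappa> f)))) = D (\<kappa> (\<rho>' f))"
    using assms by (metis comp_apply inv(2))
  then show "(\<rho>' \<circ> (inv \<kappa> \<circ> D \<circ> \<kappa>)) f = ((inv \<kappa> \<circ> D \<circ> \<kappa>) \<circ> \<rho>') f"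
    by (metis comp_apply inv(1))
qed

lemma simple_not_univariate:
  fixes D :: "'a::field_char_0 bipoly \<Rightarrow> 'a bipoly"
  assumes D: "simple_derivation D" and X: "D bX = [:a:]"
  shows "D bY \<noteq> [:b:]"
proof
  assume Y: "D bY = [:b:]"
  note d = simple_is_derivation[OF D]
  have "[:a:] dvd D [:a:]"
    using X by (simp add: derivation_const_poly[OF d])
  moreover have "a \<noteq> 0"
    using simple_semi_invariant_is_unit[OF D, of bX] X
    by (auto simp: bX_def is_unit_pCons_iff is_unit_const_poly_iff)
  ultimately have "[:a:] dvd 1"
    by (intro simple_semi_invariant_is_unit[OF D]) simp_all
  then obtain c where c: "a = [:c:]" "c \<noteq> 0"
    by (auto simp: is_unit_const_poly_iff is_unit_poly_iff dvd_field_iff)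
  obtain q where "pderiv q = smult (1 / c) b" using surj_pderiv by (metis surjE)
  then have "D (bY - [:q:]) = 0"
    using X Y c by (simp add: derivation_diff[OF d] derivation_const_poly[OF d])
  then have "bY - [:q:] dvd 1"
    by (intro simple_semi_invariant_is_unit[OF D]) (simp_all add: bY_def)
  then show False by (auto simp: bY_def is_unit_poly_iff)
qed

section \<open>Triangular automorphisms\<close>

definition triangular_map :: "'a::comm_ring_1 \<Rightarrow> 'a \<Rightarrow> 'a \<Rightarrow> 'a poly \<Rightarrow> 'a bipoly \<Rightarrow> 'a bipoly" where
  "triangular_map \<alpha> \<gamma> \<delta> p = bsubst [:[:\<gamma>, \<alpha>:]:] [:p, [:\<delta>:]:]"

definition triangular :: "('a::field bipoly \<Rightarrow> 'a bipoly) \<Rightarrow> bool" where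
  "triangular \<beta> \<longleftrightarrow> (\<exists>\<alpha> \<gamma> \<delta> p. \<alpha> \<noteq> 0 \<and> \<delta> \<noteq> 0 \<and> \<beta> = triangular_map \<alpha> \<gamma> \<delta> p)"

interpretation triangular_map: alg_hom "triangular_map \<alpha> \<gamma> \<delta> p"
  unfolding triangular_map_def by unfold_locales

lemma triangular_map_X [simp]: "triangular_map \<alpha> \<gamma> \<delta> p bX = [:[:\<gamma>, \<alpha>:]:]"
  and triangular_map_Y [simp]: "triangular_map \<alpha> \<gamma> \<delta> p bY = [:p, [:\<delta>:]:]"
  by (simp_all add: triangular_map_def)

lemma triangular_map_const_poly [simp]: "triangular_map \<alpha> \<gamma> \<delta> p [:q:] = [:pcompose q [:\<gamma>, \<alpha>:]:]"
  by (rule triangular_map.hom_const_poly_inner) simp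

lemma triangular_map_pCons:
  "triangular_map \<alpha> \<gamma> \<delta> p (pCons q f)
    = [:pcompose q [:\<gamma>, \<alpha>:]:] + [:p, [:\<delta>:]:] * triangular_map \<alpha> \<gamma> \<delta> p f"
  by (subst triangular_map.hom_pCons) simp

lemma triangular_map_id: "triangular_map 1 0 1 0 = id"
  by (rule alg_hom_eqI[OF triangular_map.alg_hom_axioms alg_hom_id])
     (simp_all, simp_all add: bX_def bY_def one_pCons)

lemma triangular_map_comp:
  "triangular_map \<alpha> \<gamma> \<delta> p \<circ> triangular_map \<alpha>' \<gamma>' \<delta>' p'
    = triangular_map (\<alpha>' * \<alpha>) (\<gamma>' + \<alpha>' * \<gamma>) (\<delta>' * \<delta>) (smult \<delta>' p + pcompose p' [:\<gamma>, \<alpha>:])"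
  by (rule alg_hom_eqI[OF alg_hom_comp])
     (simp_all add: triangular_map.alg_hom_axioms triangular_map_pCons pcompose_pCons
        mult.commute add.commute)

lemma triangular_map_inverse:
  fixes \<alpha> \<gamma> \<delta> :: "'a::field" and p :: "'a poly"
  assumes "\<alpha> \<noteq> 0" "\<delta> \<noteq> 0"
  defines "\<tau> \<equiv> triangular_map (1 / \<alpha>) (- \<gamma> / \<alpha>) (1 / \<delta>)
    (smult (- 1 / \<delta>) (pcompose p [:- \<gamma> / \<alpha>, 1 / \<alpha>:]))"
  shows "is_K_algebra_aut (triangular_map \<alpha> \<gamma> \<delta> p)" "inv (triangular_map \<alpha> \<gamma> \<delta> p) = \<tau>"
proof -
  have "pcompose (pcompose p [:- \<gamma> / \<alpha>, 1 / \<alpha>:]) [:\<gamma>, \<alpha>:] = p"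
    using assms by (simp add: pcompose_pCons flip: pcompose_assoc)
  then have "triangular_map \<alpha> \<gamma> \<delta> p \<circ> \<tau> = id" "\<tau> \<circ> triangular_map \<alpha> \<gamma> \<delta> p = id"
    unfolding \<tau>_def triangular_map_comp using assms
    by (simp_all add: pcompose_smult pcompose_uminus flip: triangular_map_id)
  then show "is_K_algebra_aut (triangular_map \<alpha> \<gamma> \<delta> p)" "inv (triangular_map \<alpha> \<gamma> \<delta> p) = \<tau>"
    by (intro autI[of _ \<tau>]; simp add: \<tau>_def triangular_map.alg_hom_axioms)+
qed

lemma triangularI: "\<alpha> \<noteq> 0 \<Longrightarrow> \<delta> \<noteq> 0 \<Longrightarrow> triangular (triangular_map \<alpha> \<gamma> \<delta> p)"
  by (auto simp: triangular_def)

lemma triangular_id: "triangular id"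
  using triangularI[of 1 1 0 0] by (simp add: triangular_map_id)

lemma aut_triangular: "triangular \<beta> \<Longrightarrow> is_K_algebra_aut \<beta>"
  by (auto simp: triangular_def triangular_map_inverse)

lemma triangular_comp: "triangular \<beta> \<Longrightarrow> triangular \<beta>' \<Longrightarrow> triangular (\<beta> \<circ> \<beta>')"
  by (auto simp: triangular_def[of \<beta>] triangular_def[of \<beta>'] triangular_map_comp intro!: triangularI)

lemma triangular_inv: "triangular \<beta> \<Longrightarrow> triangular (inv \<beta>)"
  by (auto simp: triangular_def[of \<beta>] triangular_map_inverse intro!: triangularI)

lemma triangular_map_eq_pcompose: "triangular_map 1 0 \<delta> p f = pcompose f [:p, [:\<delta>:]:]"
  by (induction f) (simp_all add: triangular_map_pCons pcompose_pCons del: mult_pCons_left)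

lemma coeff_triangular_map_diagonal:
  "coeff (triangular_map \<alpha> \<gamma> \<delta> 0 f) j = smult (\<delta> ^ j) (pcompose (coeff f j) [:\<gamma>, \<alpha>:])"
proof (induction f arbitrary: j)
  case (pCons q f)
  then show ?case by (cases j) (simp_all add: triangular_map_pCons mult.commute)
qed simp

lemma simple_triangular_fibre_scaling_eq_1:
  assumes "simple_derivation D" "triangular_map \<alpha> \<gamma> \<delta> p \<circ> D = D \<circ> triangular_map \<alpha> \<gamma> \<delta> p"
    and "triangular_map \<alpha> \<gamma> \<delta> p \<noteq> id" "\<alpha> * x + \<gamma> = x"
  shows "\<delta> = 1"
proof (rule ccontr)
  assume "\<delta> \<noteq> 1"
  define y where "y = poly p x / (1 - \<delta>)"
  have "poly p x + y * \<delta> = y" using \<open>\<delta> \<noteq> 1\<close> by (simp add: y_def field_simps)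
  then have "triangular_map \<alpha> \<gamma> \<delta> p = id"
    using assms by (intro simple_fixed_point[where x = x and y = y and D = D])
      (simp_all add: triangular_map.alg_hom_axioms algebra_simps)
  then show False using assms by blast
qed

lemma triangular_map_restrict_invariant_line:
  assumes "\<alpha> * x + \<gamma> = x"
  shows "bsubst (bconst x) bY \<circ> triangular_map \<alpha> \<gamma> 1 p
    = triangular_map 1 0 1 [:poly p x:] \<circ> bsubst (bconst x) bY"
    (is "?\<epsilon> \<circ> ?\<beta> = ?\<tau> \<circ> _")
proof (rule alg_hom_eqI)
  have poly: "?\<epsilon> [:q:] = [:[:poly q x:]:]" for q
    by (subst bsubst.hom_const_poly_inner[of _ _ "[:x:]"]) (simp_all add: bconst_def pcompose_pCons_0)
  show "(?\<epsilon> \<circ> ?\<beta>) bX = (?\<tau> \<circ> ?\<epsilon>) bX"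
    using assms by (simp add: poly) (simp add: bconst_def algebra_simps)
  show "(?\<epsilon> \<circ> ?\<beta>) bY = (?\<tau> \<circ> ?\<epsilon>) bY"
    by (simp add: bsubst.hom_pCons[of _ _ p "[:[:1:]:]"] poly) (simp add: bY_def)
qed (intro alg_hom_comp bsubst.alg_hom_axioms triangular_map.alg_hom_axioms)+

lemma vertical_shift_eigenvector_eq_0:
  fixes f :: "'a::field bipoly"
  assumes "triangular_map 1 0 1 [:c:] f = bconst \<alpha> * f" "\<alpha> \<noteq> 1"
  shows "f = 0"
proof -
  have "pcompose f [:[:c:], 1:] = smult [:\<alpha>:] f"
    using assms(1) by (simp add: triangular_map_eq_pcompose bconst_def one_pCons)
  then have "lead_coeff f = smult \<alpha> (lead_coeff f)"
    using lead_coeff_shift[of f "[:c:]"] lead_coeff_smult[of "[:\<alpha>:]" f] by simp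
  then have "smult (1 - \<alpha>) (lead_coeff f) = 0" by (simp add: smult_diff_left)
  then show ?thesis using \<open>\<alpha> \<noteq> 1\<close> by simp
qed

text \<open>The iterates \<open>D\<^sup>k (x - x\<^sub>0)\<close>, where \<open>x = x\<^sub>0\<close> is the line fixed by \<open>\<beta>\<close>, are eigenvectors of \<open>\<beta>\<close> for the
  eigenvalue \<open>\<alpha>\<close>. They vanish on that line, because \<open>\<beta>\<close> restricts to a translation of it.\<close>
lemma simple_triangular_base_scaling_eq_1:
  assumes D: "simple_derivation D" and comm: "triangular_map \<alpha> \<gamma> \<delta> p \<circ> D = D \<circ> triangular_map \<alpha> \<gamma> \<delta> p"
  shows "\<alpha> = 1"
proof (rule ccontr)
  assume "\<alpha> \<noteq> 1"
  define \<beta> where "\<beta> = triangular_map \<alpha> \<gamma> \<delta> p"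
  define x where "x = \<gamma> / (1 - \<alpha>)"
  have x: "\<alpha> * x + \<gamma> = x" using \<open>\<alpha> \<noteq> 1\<close> by (simp add: x_def field_simps)
  have "\<beta> bX \<noteq> id bX" using \<open>\<alpha> \<noteq> 1\<close> unfolding \<beta>_def triangular_map_X by (simp add: bX_def)
  then have "\<delta> = 1" using simple_triangular_fibre_scaling_eq_1[OF D comm _ x] unfolding \<beta>_def by metis
  define \<epsilon> where "\<epsilon> = bsubst (bconst x) bY"
  interpret \<epsilon>: alg_hom \<epsilon> unfolding \<epsilon>_def by unfold_locales
  interpret \<beta>: alg_hom \<beta> unfolding \<beta>_def by unfold_locales
  have restrict: "\<epsilon> \<circ> \<beta> = triangular_map 1 0 1 [:poly p x:] \<circ> \<epsilon>"
    unfolding \<epsilon>_def \<beta>_def \<open>\<delta> = 1\<close> by (rule triangular_map_restrict_invariant_line[OF x])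
  define f where "f = bX - bconst x"
  have "\<beta> ((D ^^ k) f) = bconst \<alpha> * (D ^^ k) f" for k
  proof (induction k)
    case 0
    have "\<gamma> - x = - (\<alpha> * x)" using x by (simp add: algebra_simps)
    then show ?case by (simp add: \<beta>_def f_def) (simp add: bX_def bconst_def)
  next
    case (Suc k)
    have "\<beta> (D g) = D (\<beta> g)" for g using comm by (metis \<beta>_def comp_apply)
    then show ?case using Suc by (simp add: derivation_scale[OF simple_is_derivation[OF D]])
  qed
  then have "triangular_map 1 0 1 [:poly p x:] (\<epsilon> ((D ^^ k) f)) = bconst \<alpha> * \<epsilon> ((D ^^ k) f)" for k
    using fun_cong[OF restrict, of "(D ^^ k) f"] by simp
  then have "\<epsilon> ((D ^^ k) f) = 0" for k
    using vertical_shift_eigenvector_eq_0 \<open>\<alpha> \<noteq> 1\<close> by blast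
  then have "f = 0"
    by (intro simple_iterates_in_ideal[OF D, of "{g. \<epsilon> g = 0}"]) (simp_all add: is_ideal_def)
  then show False by (simp add: f_def bX_def bconst_def)
qed

lemma ex_bswap_eq_const_poly:
  assumes "\<And>j. degree (coeff f j) = 0"
  obtains q where "bswap f = [:q:]"
proof
  show "bswap f = [:map_poly (\<lambda>p. coeff p 0) f:]"
    using assms
    by (intro poly_eqI) (auto simp: coeff_bswap coeff_map_poly coeff_pCons coeff_eq_0 split: nat.splits)
qed

lemma simple_no_diagonal_translation:
  fixes D :: "'a::field_char_0 bipoly \<Rightarrow> 'a bipoly"
  assumes D: "simple_derivation D" and "\<gamma> \<noteq> 0" "\<delta> \<noteq> 0"
  shows "triangular_map 1 \<gamma> \<delta> 0 \<circ> D \<noteq> D \<circ> triangular_map 1 \<gamma> \<delta> 0"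
proof
  assume "triangular_map 1 \<gamma> \<delta> 0 \<circ> D = D \<circ> triangular_map 1 \<gamma> \<delta> 0"
  then have comm: "triangular_map 1 \<gamma> \<delta> 0 (D f) = D (triangular_map 1 \<gamma> \<delta> 0 f)" for f
    by (metis comp_apply)
  have eigenvector: "\<exists>q. bswap f = [:q:]"
    if f: "triangular_map 1 \<gamma> \<delta> 0 f = bconst c * f" and "c \<noteq> 0" for f c
  proof -
    have "smult (\<delta> ^ j) (pcompose (coeff f j) [:\<gamma>, 1:]) = smult c (coeff f j)" for j
      using arg_cong[OF f, of "\<lambda>f. coeff f j"] by (simp add: coeff_triangular_map_diagonal bconst_def)
    then have "smult (1 / c) (smult (\<delta> ^ j) (pcompose (coeff f j) [:\<gamma>, 1:])) = coeff f j" for j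
      using \<open>c \<noteq> 0\<close> by simp
    then have "degree (coeff f j) = 0" for j
      using shift_eigenvector_imp_const[of "1 / c * \<delta> ^ j" "coeff f j" \<gamma>] \<open>\<gamma> \<noteq> 0\<close> by simp
    then show ?thesis using ex_bswap_eq_const_poly by blast
  qed
  note d = simple_is_derivation[OF D]
  have X: "triangular_map 1 \<gamma> \<delta> 0 bX = bX + bconst \<gamma>" and Y: "triangular_map 1 \<gamma> \<delta> 0 bY = bconst \<delta> * bY"
    by (simp_all, simp_all add: bX_def bY_def bconst_def)
  have "triangular_map 1 \<gamma> \<delta> 0 (D bX) = bconst 1 * D bX"
    unfolding comm X by (simp add: derivation_add[OF d] derivation_const[OF d])
  then obtain a where a: "bswap (D bX) = [:a:]" using eigenvector one_neq_zero by blast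
  have "triangular_map 1 \<gamma> \<delta> 0 (D bY) = bconst \<delta> * D bY"
    unfolding comm Y by (rule derivation_scale[OF d])
  then obtain b where "bswap (D bY) = [:b:]" using eigenvector \<open>\<delta> \<noteq> 0\<close> by blast
  then show False
    using simple_not_univariate[OF simple_conj[OF D aut_bswap], of b a] a by (simp add: inv_bswap)
qed

lemma simple_triangular_base_translation_eq_0:
  fixes D :: "'a::field_char_0 bipoly \<Rightarrow> 'a bipoly"
  assumes D: "simple_derivation D" and "\<delta> \<noteq> 0"
    and comm: "triangular_map 1 \<gamma> \<delta> p \<circ> D = D \<circ> triangular_map 1 \<gamma> \<delta> p"
  shows "\<gamma> = 0"
proof (rule ccontr)
  assume "\<gamma> \<noteq> 0"
  obtain s where s: "pcompose s [:\<gamma>, 1:] - smult \<delta> s = - p"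
    using surjD[OF surj_scaled_difference[OF \<open>\<gamma> \<noteq> 0\<close>, of \<delta>], of "- p"] by auto
  define \<kappa> where "\<kappa> = triangular_map 1 0 1 s"
  have \<kappa>: "is_K_algebra_aut \<kappa>" unfolding \<kappa>_def by (rule triangular_map_inverse) simp_all
  have conj: "\<kappa> \<circ> triangular_map 1 \<gamma> \<delta> 0 = triangular_map 1 \<gamma> \<delta> p \<circ> \<kappa>"
    unfolding \<kappa>_def triangular_map_comp using s by (simp add: diff_eq_eq)
  show False
    using simple_no_diagonal_translation[OF simple_conj[OF D \<kappa>] \<open>\<gamma> \<noteq> 0\<close> \<open>\<delta> \<noteq> 0\<close>]
      commute_conj[OF _ conj comm] \<kappa> by (simp add: is_K_algebra_aut_iff)
qed

lemma simple_triangular_vertical_eq_id: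
  fixes D :: "'a::field_char_0 bipoly \<Rightarrow> 'a bipoly"
  assumes D: "simple_derivation D" and comm: "triangular_map 1 0 \<delta> p \<circ> D = D \<circ> triangular_map 1 0 \<delta> p"
  shows "triangular_map 1 0 \<delta> p = id"
proof (rule ccontr)
  assume ne: "triangular_map 1 0 \<delta> p \<noteq> id"
  have "\<delta> = 1" by (rule simple_triangular_fibre_scaling_eq_1[OF D comm ne, of 0]) simp
  define \<beta> where "\<beta> = triangular_map 1 0 1 p"
  have comm': "\<beta> (D f) = D (\<beta> f)" for f
    using comm by (metis \<beta>_def \<open>\<delta> = 1\<close> comp_apply)
  have X: "\<beta> bX = bX" and Y: "\<beta> bY = bY + [:p:]"
    by (simp_all add: \<beta>_def, simp_all add: bX_def bY_def one_pCons)
  have "[:p:] dvd 1"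
  proof (rule ccontr)
    assume "\<not> [:p:] dvd 1"
    then have "\<beta> = id"
      using comm' by (intro simple_fixed_point_ideal[OF D _ _ is_ideal_multiples[of "[:p:]"]])
        (simp_all add: X Y fun_eq_iff, simp add: \<beta>_def triangular_map.alg_hom_axioms)
    then show False using ne by (simp add: \<beta>_def \<open>\<delta> = 1\<close>)
  qed
  then obtain c where c: "p = [:c:]" "c \<noteq> 0"
    by (auto simp: is_unit_const_poly_iff is_unit_poly_iff dvd_field_iff)
  have invariant: "\<exists>a. f = [:a:]" if "\<beta> f = f" for f
  proof -
    have "degree f = 0"
      by (rule shift_invariant_imp_const[of f "[:c:]"])
         (use that c in \<open>simp_all add: \<beta>_def triangular_map_eq_pcompose one_pCons\<close>)
    then show ?thesis by (metis degree_eq_zeroE)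
  qed
  have "D [:p:] = 0"
    using derivation_const_poly[OF simple_is_derivation[OF D], of p] by (simp add: c)
  then have "\<beta> (D bX) = D bX" "\<beta> (D bY) = D bY"
    by (simp_all add: comm' X Y derivation_add[OF simple_is_derivation[OF D]])
  then show False using invariant simple_not_univariate[OF D] by blast
qed

lemma simple_triangular_eq_id:
  fixes D :: "'a::field_char_0 bipoly \<Rightarrow> 'a bipoly"
  assumes "simple_derivation D" "triangular \<beta>" "\<beta> \<circ> D = D \<circ> \<beta>"
  shows "\<beta> = id"
proof -
  obtain \<alpha> \<gamma> \<delta> p where \<beta>: "\<beta> = triangular_map \<alpha> \<gamma> \<delta> p" and "\<delta> \<noteq> 0"
    using assms(2) by (auto simp: triangular_def)
  have "\<alpha> = 1" using simple_triangular_base_scaling_eq_1 assms unfolding \<beta> by blast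
  moreover from this have "\<gamma> = 0"
    using simple_triangular_base_translation_eq_0 assms \<open>\<delta> \<noteq> 0\<close> unfolding \<beta> by blast
  ultimately show ?thesis using simple_triangular_vertical_eq_id assms unfolding \<beta> by blast
qed

section \<open>Total degree and leading forms\<close>

text \<open>The substitution \<open>x = t\<close>, \<open>y = u t\<close>, with \<open>t\<close> as the outer and \<open>u\<close> as the inner variable, turns the
  total degree into the degree in \<open>t\<close> and the leading form into the leading coefficient,
  dehomogenised to a polynomial in \<open>u\<close>.\<close>
definition blowup :: "'a::comm_ring_1 bipoly \<Rightarrow> 'a bipoly" where
  "blowup = bsubst bY (bX * bY)"

definition tdeg :: "'a::comm_ring_1 bipoly \<Rightarrow> nat" where
  "tdeg f = degree (blowup f)"

definition lead_form :: "'a::comm_ring_1 bipoly \<Rightarrow> 'a poly" where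
  "lead_form f = lead_coeff (blowup f)"

interpretation blowup: alg_hom blowup
  unfolding blowup_def by unfold_locales

lemma blowup_X [simp]: "blowup bX = bY" and blowup_Y [simp]: "blowup bY = bX * bY"
  by (simp_all add: blowup_def)

lemma coeff_blowup: "coeff (coeff (blowup f) k) j = (if j \<le> k then coeff (coeff f j) (k - j) else 0)"
proof (induction f arbitrary: j k)
  case (pCons p f)
  have "blowup (pCons p f) = map_poly (\<lambda>c. [:c:]) p + bX * bY * blowup f"
    by (simp add: blowup.hom_pCons[of p f] blowup.hom_const_poly) (simp add: bY_def)
  moreover have "coeff (bX * bY * g) k = (case k of 0 \<Rightarrow> 0 | Suc k' \<Rightarrow> pCons 0 (coeff g k'))"
    for g :: "'a bipoly"
    by (simp add: bX_def bY_def coeff_pCons split: nat.splits)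
  ultimately show ?case
    using pCons by (simp add: coeff_map_poly coeff_pCons split: nat.splits)
qed simp

lemma coeff_eq_coeff_blowup: "coeff (coeff f j) i = coeff (coeff (blowup f) (i + j)) j"
  by (simp add: coeff_blowup)

lemma blowup_eq_0_iff [simp]: "blowup f = 0 \<longleftrightarrow> f = 0"
proof
  assume "blowup f = 0"
  then show "f = 0" by (intro poly_eqI) (simp add: coeff_eq_coeff_blowup)
qed simp

lemma lead_form_eq_0_iff [simp]: "lead_form f = 0 \<longleftrightarrow> f = 0"
  by (simp add: lead_form_def)

lemma tdeg_le_iff: "tdeg f \<le> n \<longleftrightarrow> (\<forall>i j. coeff (coeff f j) i \<noteq> 0 \<longrightarrow> i + j \<le> n)"
proof
  assume "tdeg f \<le> n"
  then have "coeff (blowup f) k = 0" if "k > n" for k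
    using that by (simp add: tdeg_def coeff_eq_0)
  then show "\<forall>i j. coeff (coeff f j) i \<noteq> 0 \<longrightarrow> i + j \<le> n"
    unfolding coeff_eq_coeff_blowup[of f] by (metis coeff_0 not_le)
next
  assume "\<forall>i j. coeff (coeff f j) i \<noteq> 0 \<longrightarrow> i + j \<le> n"
  then have "coeff (coeff f j) i = 0" if "i + j > n" for i j
    using that by (metis not_le)
  then have "coeff (coeff (blowup f) k) j = 0" if "k > n" for k j
    using that by (simp add: coeff_blowup)
  then show "tdeg f \<le> n"
    unfolding tdeg_def by (intro degree_le) (auto intro: poly_eqI)
qed

lemma tdeg_leD: "coeff (coeff f j) i \<noteq> 0 \<Longrightarrow> i + j \<le> tdeg f"
  using tdeg_le_iff by blast

lemma tdeg_const [simp]: "tdeg (bconst c) = 0"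
  by (simp add: tdeg_def) (simp add: bconst_def)

lemma tdeg_eq_0_iff: "tdeg f = 0 \<longleftrightarrow> (\<exists>c. f = bconst c)"
proof
  assume "tdeg f = 0"
  then have "coeff (coeff f j) i = 0" if "i + j > 0" for i j
    using tdeg_leD[of f j i] that by auto
  then have "f = bconst (coeff (coeff f 0) 0)"
    by (intro poly_eqI) (auto simp: bconst_def coeff_pCons split: nat.splits)
  then show "\<exists>c. f = bconst c" ..
qed auto

lemma tdeg_X [simp]: "tdeg bX = 1" and tdeg_Y [simp]: "tdeg bY = 1"
  by (simp_all add: tdeg_def) (simp_all add: bX_def bY_def)

lemma tdeg_bswap [simp]: "tdeg (bswap f) = tdeg f"
proof -
  have "tdeg (bswap f) \<le> n \<longleftrightarrow> tdeg f \<le> n" for n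
    unfolding tdeg_le_iff coeff_bswap by (metis add.commute)
  then show ?thesis by (metis le_antisym order_refl)
qed

lemma tdeg_diff_le: "tdeg f \<le> n \<Longrightarrow> tdeg g \<le> n \<Longrightarrow> tdeg (f - g) \<le> n"
  by (simp add: tdeg_def degree_diff_le)

lemma tdeg_mult_le: "tdeg (f * g) \<le> tdeg f + tdeg g"
  by (simp add: tdeg_def degree_mult_le)

lemma tdeg_mult:
  fixes f g :: "'a::idom bipoly"
  assumes "f \<noteq> 0" "g \<noteq> 0"
  shows "tdeg (f * g) = tdeg f + tdeg g"
  using assms by (simp add: tdeg_def degree_mult_eq)

lemma tdeg_scale: "c \<noteq> 0 \<Longrightarrow> tdeg (bconst c * f) = tdeg (f :: 'a::idom bipoly)"
  by (cases "f = 0") (simp_all add: tdeg_mult)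

lemma lead_form_mult: "lead_form (f * g) = lead_form f * lead_form (g :: 'a::idom bipoly)"
  by (simp add: lead_form_def lead_coeff_mult)

lemma lead_form_const [simp]: "lead_form (bconst c) = [:c:]"
  by (simp add: lead_form_def) (simp add: bconst_def)

lemma tdeg_power: "tdeg (f ^ n) = n * tdeg (f :: 'a::idom bipoly)" if "f \<noteq> 0"
  using that by (simp add: tdeg_def degree_power_eq)

lemma lead_form_power: "lead_form (f ^ n) = lead_form (f :: 'a::idom bipoly) ^ n"
  by (simp add: lead_form_def lead_coeff_power)

lemma tdeg_add_eq_right:
  assumes "tdeg f < tdeg g"
  shows "tdeg (f + g) = tdeg g" "lead_form (f + g) = lead_form g"
  using assms by (simp_all add: tdeg_def lead_form_def degree_add_eq_right coeff_eq_0)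

lemma tdeg_diff_less:
  assumes "tdeg f = tdeg g" "lead_form f = lead_form g" "tdeg f > 0"
  shows "tdeg (f - g) < tdeg f"
proof -
  have "coeff (blowup (f - g)) i = 0" if "i \<ge> tdeg f" for i
    using that assms by (cases "i = tdeg f") (auto simp: tdeg_def lead_form_def coeff_eq_0)
  then show ?thesis
    unfolding tdeg_def[of "f - g"] using assms(3) by (intro degree_lessI) auto
qed

lemma degree_lead_form_le: "degree (lead_form f) \<le> degree f"
  by (rule degree_le) (auto simp: lead_form_def coeff_blowup coeff_eq_0)

lemma lead_coeff_of_lead_form_monom:
  assumes "lead_form f = monom c (tdeg f)" "c \<noteq> 0"
  shows "degree f = tdeg f" "lead_coeff f = [:c:]"
proof -
  have "tdeg f \<le> degree f" using degree_lead_form_le[of f] assms by (simp add: degree_monom_eq)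
  moreover have "degree f \<le> tdeg f"
    by (rule degree_le) (use tdeg_leD[of f] in \<open>fastforce intro!: poly_eqI\<close>)
  ultimately show deg: "degree f = tdeg f" by simp
  show "lead_coeff f = [:c:]"
  proof (rule poly_eqI)
    fix i
    have "coeff (coeff f (tdeg f)) i = coeff (coeff (blowup f) (i + tdeg f)) (tdeg f)"
      by (rule coeff_eq_coeff_blowup)
    then show "coeff (lead_coeff f) i = coeff [:c:] i"
      using assms(1) unfolding deg
      by (cases i) (simp_all add: lead_form_def tdeg_def coeff_eq_0)
  qed
qed

lemma tdeg_aut_pos:
  assumes "is_K_algebra_aut \<rho>"
  shows "tdeg (\<rho> bX) > 0" "tdeg (\<rho> bY) > 0"
  using aut_generators_not_const[OF assms] tdeg_eq_0_iff by blast+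

section \<open>The Jacobian determinant\<close>

definition jacobian :: "'a::idom bipoly \<Rightarrow> 'a bipoly \<Rightarrow> 'a bipoly" where
  "jacobian f g = inner_pderiv f * pderiv g - pderiv f * inner_pderiv g"

lemma jacobian_self [simp]: "jacobian f f = 0"
  by (simp add: jacobian_def mult.commute)

lemma jacobian_antisym: "jacobian g f = - jacobian f g"
  by (simp add: jacobian_def mult.commute)

lemma jacobian_X_Y [simp]: "jacobian bX bY = 1"
  by (simp add: jacobian_def)

lemma is_derivation_jacobian: "is_derivation (jacobian f)"
  by (simp add: is_derivation_def jacobian_def inner_pderiv_add inner_pderiv_mult pderiv_add pderiv_mult
      algebra_simps)

lemma jacobian_hom_right:
  fixes \<rho> :: "'a::field bipoly \<Rightarrow> 'a bipoly"
  assumes "alg_hom \<rho>"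
  shows "jacobian (\<rho> bX) (\<rho> f) = jacobian (\<rho> bX) (\<rho> bY) * \<rho> (pderiv f)"
    and "jacobian (\<rho> bY) (\<rho> f) = - jacobian (\<rho> bX) (\<rho> bY) * \<rho> (inner_pderiv f)"
  by (simp_all add: derivation_hom_chain_rule[OF is_derivation_jacobian assms, of _ f]
      jacobian_antisym[of "\<rho> bY" "\<rho> bX"])

lemma jacobian_hom:
  fixes \<rho> :: "'a::field bipoly \<Rightarrow> 'a bipoly"
  assumes "alg_hom \<rho>"
  shows "jacobian (\<rho> f) (\<rho> g) = \<rho> (jacobian f g) * jacobian (\<rho> bX) (\<rho> bY)"
proof -
  interpret alg_hom \<rho> by fact
  have "jacobian (\<rho> f) (\<rho> g)
      = jacobian (\<rho> f) (\<rho> bX) * \<rho> (inner_pderiv g) + jacobian (\<rho> f) (\<rho> bY) * \<rho> (pderiv g)"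
    by (rule derivation_hom_chain_rule[OF is_derivation_jacobian assms])
  also have "\<dots> = \<rho> (jacobian f g) * jacobian (\<rho> bX) (\<rho> bY)"
    unfolding jacobian_antisym[of "\<rho> f" "\<rho> bX"] jacobian_antisym[of "\<rho> f" "\<rho> bY"]
      jacobian_hom_right[OF assms, of f]
    by (simp add: jacobian_def[of f g] algebra_simps)
  finally show ?thesis .
qed

lemma jacobian_aut:
  assumes "is_K_algebra_aut \<rho>"
  obtains c where "c \<noteq> 0" "jacobian (\<rho> bX) (\<rho> bY) = bconst c"
proof -
  have "1 = \<rho> (jacobian (inv \<rho> bX) (inv \<rho> bY)) * jacobian (\<rho> bX) (\<rho> bY)"
    using jacobian_hom[OF aut_alg_hom[OF assms], of "inv \<rho> bX" "inv \<rho> bY"]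
    by (simp add: aut_inv_apply_right[OF assms])
  then have "jacobian (\<rho> bX) (\<rho> bY) dvd 1" by (metis dvd_triv_right)
  then show ?thesis
    using that by (auto simp: is_unit_poly_iff bconst_def dvd_field_iff)
qed

lemma tdeg_partial_derivative_le:
  "tdeg (pderiv f) \<le> tdeg f - 1" "tdeg (inner_pderiv f) \<le> tdeg f - 1"
proof -
  have "coeff (coeff (pderiv f) j) i = of_nat (Suc j) * coeff (coeff f (Suc j)) i" for i j
    by (simp add: coeff_pderiv of_nat_mult_conv_smult del: of_nat_Suc)
  then show "tdeg (pderiv f) \<le> tdeg f - 1"
    unfolding tdeg_le_iff by (auto dest!: tdeg_leD)
  show "tdeg (inner_pderiv f) \<le> tdeg f - 1"
    unfolding tdeg_le_iff by (auto simp: coeff_inner_pderiv coeff_pderiv dest!: tdeg_leD)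
qed

lemma tdeg_jacobian_le:
  assumes "jacobian f g \<noteq> 0"
  shows "tdeg (jacobian f g) + 2 \<le> tdeg f + tdeg g"
proof -
  have "tdeg f \<noteq> 0" "tdeg g \<noteq> 0"
    using assms by (auto simp: tdeg_eq_0_iff jacobian_def)
  moreover have "tdeg (jacobian f g) \<le> (tdeg f - 1) + (tdeg g - 1)"
    unfolding jacobian_def using tdeg_partial_derivative_le[of f] tdeg_partial_derivative_le[of g]
    by (intro tdeg_diff_le order.trans[OF tdeg_mult_le]) auto
  ultimately show ?thesis by linarith
qed

lemma jacobian_blowup: "jacobian (blowup f) (blowup g) = - bY * blowup (jacobian f g)"
  for f g :: "'a::field bipoly"
  unfolding jacobian_hom[OF blowup.alg_hom_axioms, of f g] by (simp add: jacobian_def inner_pderiv_mult)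

lemma lead_form_jacobian_degenerate:
  fixes f g :: "'a::field bipoly"
  assumes "tdeg f > 0" "tdeg g > 0" "tdeg (jacobian f g) + 2 < tdeg f + tdeg g"
  shows "of_nat (tdeg f) * lead_form f * pderiv (lead_form g)
    = of_nat (tdeg g) * pderiv (lead_form f) * lead_form g"
proof -
  have top: "coeff (inner_pderiv (blowup h) * pderiv (blowup k)) (tdeg h + tdeg k - 1)
      = pderiv (lead_form h) * (of_nat (tdeg k) * lead_form k)" if "tdeg k > 0" for h k :: "'a bipoly"
  proof -
    obtain n where n: "tdeg k = Suc n" using \<open>tdeg k > 0\<close> by (metis gr0_conv_Suc)
    have "coeff (inner_pderiv (blowup h) * pderiv (blowup k)) (tdeg h + n)
        = coeff (inner_pderiv (blowup h)) (tdeg h) * coeff (pderiv (blowup k)) n"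
      by (rule coeff_mult_top)
         (use n in \<open>auto simp: tdeg_def coeff_inner_pderiv coeff_pderiv coeff_eq_0 intro!: degree_le\<close>)
    then show ?thesis
      using n by (simp add: tdeg_def lead_form_def coeff_inner_pderiv coeff_pderiv del: of_nat_Suc)
  qed
  have "degree (jacobian (blowup f) (blowup g)) \<le> Suc (tdeg (jacobian f g))"
    unfolding jacobian_blowup tdeg_def by (rule order.trans[OF degree_mult_le]) (simp add: bY_def)
  then have "coeff (jacobian (blowup f) (blowup g)) (tdeg f + tdeg g - 1) = 0"
    using assms by (intro coeff_eq_0) linarith
  then have "pderiv (lead_form f) * (of_nat (tdeg g) * lead_form g)
      = pderiv (lead_form g) * (of_nat (tdeg f) * lead_form f)"
    using top[of g f] top[of f g] assms(1,2) by (simp add: jacobian_def mult.commute add.commute)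
  then show ?thesis by (simp add: mult_ac)
qed

lemma ex_power_reducing_tdeg:
  fixes f g :: "'a::field_char_0 bipoly"
  assumes "tdeg f > 0" "tdeg g > 0" "tdeg g = k * tdeg f" "tdeg (jacobian f g) + 2 < tdeg f + tdeg g"
  obtains c where "tdeg (g - bconst c * f ^ k) < tdeg g"
proof -
  have nz: "f \<noteq> 0" "g \<noteq> 0" using assms(1,2) by (auto simp: tdeg_def)
  have "of_nat (tdeg f) * (lead_form f * pderiv (lead_form g))
      = of_nat (tdeg f) * (of_nat k * pderiv (lead_form f) * lead_form g)"
    using lead_form_jacobian_degenerate[OF assms(1,2,4)] by (simp add: assms(3) mult_ac)
  then have "lead_form f * pderiv (lead_form g) = of_nat k * pderiv (lead_form f) * lead_form g"
    using assms(1) by simp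
  then obtain c where c: "lead_form g = smult c (lead_form f ^ k)"
    using log_derivative_eq_imp_power nz by (metis lead_form_eq_0_iff)
  then have "c \<noteq> 0" using nz by (metis lead_form_eq_0_iff smult_0_left)
  have "tdeg (g - bconst c * f ^ k) < tdeg g"
    by (rule tdeg_diff_less)
       (use assms nz c \<open>c \<noteq> 0\<close> in \<open>simp_all add: tdeg_scale tdeg_power lead_form_mult lead_form_power\<close>)
  then show ?thesis by (rule that)
qed

section \<open>Degree estimates of Shestakov and Umirbaev\<close>

definition weight_le :: "nat \<Rightarrow> nat \<Rightarrow> nat \<Rightarrow> 'a::zero bipoly \<Rightarrow> bool" where
  "weight_le m n w P \<longleftrightarrow> (\<forall>i j. coeff (coeff P j) i \<noteq> 0 \<longrightarrow> m * i + n * j \<le> w)"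

text \<open>The part of \<open>P\<close> of weight \<open>w\<close>, for the weights \<open>m\<close> of \<open>x\<close> and \<open>n\<close> of \<open>y\<close>, with \<open>\<phi>\<close>
  substituted for \<open>x\<close>.\<close>
definition weight_part :: "'a::comm_semiring_1 poly \<Rightarrow> nat \<Rightarrow> nat \<Rightarrow> nat \<Rightarrow> 'a bipoly \<Rightarrow> 'a bipoly" where
  "weight_part \<phi> m n w P = (\<Sum>j\<le>degree P. monom
     (if n * j \<le> w \<and> m dvd w - n * j
      then smult (coeff (coeff P j) ((w - n * j) div m)) (\<phi> ^ ((w - n * j) div m)) else 0) j)"

lemma coeff_weight_part: "coeff (weight_part \<phi> m n w P) j =
    (if n * j \<le> w \<and> m dvd w - n * j
     then smult (coeff (coeff P j) ((w - n * j) div m)) (\<phi> ^ ((w - n * j) div m)) else 0)"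
proof -
  have "coeff (\<Sum>j\<le>N. monom (a j) j) j = (if j \<le> N then a j else 0)" for N and a :: "nat \<Rightarrow> 'a poly"
    by (simp add: coeff_sum)
  then show ?thesis by (auto simp: weight_part_def coeff_eq_0)
qed

lemma ex_weight:
  fixes P :: "'a::comm_ring_1 bipoly"
  assumes "P \<noteq> 0"
  obtains i j where "coeff (coeff P j) i \<noteq> 0" "weight_le m n (m * i + n * j) P"
proof -
  define W where "W = {m * i + n * j | i j. coeff (coeff P j) i \<noteq> 0}"
  have "m * i + n * j \<le> (m + n) * tdeg P" if "coeff (coeff P j) i \<noteq> 0" for i j
  proof -
    have "m * i \<le> m * tdeg P" "n * j \<le> n * tdeg P" using tdeg_leD[OF that] by simp_all
    then show ?thesis unfolding distrib_right by (rule add_mono)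
  qed
  then have "finite W" by (intro finite_subset[of W "{..(m + n) * tdeg P}"]) (auto simp: W_def)
  moreover have "W \<noteq> {}" using assms by (auto simp: W_def poly_eq_iff)
  ultimately have "Max W \<in> W" "\<And>w. w \<in> W \<Longrightarrow> w \<le> Max W" by simp_all
  then show ?thesis using that by (force simp: W_def weight_le_def)
qed

lemma coeff_higher_pderiv_inner:
  "coeff (coeff ((pderiv ^^ q) P) j) i = of_nat (pochhammer (Suc j) q) * coeff (coeff P (j + q)) i"
  by (simp only: coeff_higher_pderiv pochhammer_of_nat of_nat_mult_conv_smult coeff_smult)

lemma weight_le_higher_pderiv:
  assumes "weight_le m n w P"
  shows "weight_le m n (w - q * n) ((pderiv ^^ q) P)"
  unfolding weight_le_def
proof (intro allI impI)
  fix i j assume "coeff (coeff ((pderiv ^^ q) P) j) i \<noteq> 0"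
  then have "coeff (coeff P (j + q)) i \<noteq> 0" by (auto simp: coeff_higher_pderiv_inner)
  then have "m * i + n * (j + q) \<le> w" using assms unfolding weight_le_def by blast
  then show "m * i + n * j \<le> w - q * n" by (simp add: algebra_simps)
qed

lemma weight_part_higher_pderiv:
  fixes P :: "'a::idom bipoly"
  assumes "q * n \<le> w"
  shows "weight_part \<phi> m n (w - q * n) ((pderiv ^^ q) P) = (pderiv ^^ q) (weight_part \<phi> m n w P)"
proof (rule poly_eqI)
  fix j
  have "n * j \<le> w - q * n \<longleftrightarrow> n * (j + q) \<le> w" "w - q * n - n * j = w - n * (j + q)"
    using assms by (auto simp: algebra_simps)
  then show "coeff (weight_part \<phi> m n (w - q * n) ((pderiv ^^ q) P)) j
      = coeff ((pderiv ^^ q) (weight_part \<phi> m n w P)) j"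
    by (simp add: coeff_weight_part coeff_higher_pderiv_inner)
       (simp add: coeff_higher_pderiv coeff_weight_part pochhammer_of_nat of_nat_mult_conv_smult mult.commute
          del: of_nat_Suc)
qed

lemma coeff_top_weight_monomial:
  fixes f g :: "'a::comm_ring_1 bipoly"
  assumes "degree f \<le> m" "degree g \<le> n" and weight: "c \<noteq> 0 \<Longrightarrow> m * i + n * j \<le> w"
  shows "coeff (bconst c * f ^ i * g ^ j) w
    = (if m * i + n * j = w then smult c (coeff f m ^ i * coeff g n ^ j) else 0)"
proof (cases "c = 0")
  case False
  note f = coeff_power_top[OF assms(1), of i] and g = coeff_power_top[OF assms(2), of j]
  have "coeff (f ^ i * g ^ j) (m * i + n * j) = coeff f m ^ i * coeff g n ^ j"
    using coeff_mult_top[OF f(1) g(1)] f(2) g(2) by simp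
  moreover have "degree (f ^ i * g ^ j) \<le> m * i + n * j"
    using degree_mult_le[of "f ^ i" "g ^ j"] f(1) g(1) by linarith
  ultimately have "coeff (f ^ i * g ^ j) w = (if m * i + n * j = w then coeff f m ^ i * coeff g n ^ j else 0)"
    using weight[OF False] by (auto simp: coeff_eq_0)
  then show ?thesis by (simp add: bconst_def mult.assoc)
qed simp

lemma coeff_top_weight_hom:
  assumes "alg_hom \<sigma>" and P: "weight_le m n w P" and "m > 0"
    and deg: "degree (\<sigma> bX) \<le> m" "degree (\<sigma> bY) \<le> n"
  shows "coeff (\<sigma> P) w = poly (weight_part (coeff (\<sigma> bX) m) m n w P) (coeff (\<sigma> bY) n)"
proof -
  interpret alg_hom \<sigma> by fact
  define \<phi> \<gamma> where "\<phi> = coeff (\<sigma> bX) m" "\<gamma> = coeff (\<sigma> bY) n"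
  have inner: "(\<Sum>i\<le>degree (coeff P j).
        if m * i + n * j = w then smult (coeff (coeff P j) i) (\<phi> ^ i * \<gamma> ^ j) else 0)
      = coeff (weight_part \<phi> m n w P) j * \<gamma> ^ j" for j
  proof (cases "n * j \<le> w \<and> m dvd w - n * j")
    case True
    then obtain k where k: "w - n * j = m * k" by auto
    then have "m * i + n * j = w \<longleftrightarrow> i = k" for i using True \<open>m > 0\<close> by auto
    then have "(\<Sum>i\<le>degree (coeff P j).
        if m * i + n * j = w then smult (coeff (coeff P j) i) (\<phi> ^ i * \<gamma> ^ j) else 0)
      = smult (coeff (coeff P j) k) (\<phi> ^ k * \<gamma> ^ j)"
      by (simp add: coeff_eq_0)
    then show ?thesis using True k \<open>m > 0\<close> by (simp add: coeff_weight_part)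
  next
    case False
    then have "m * i + n * j \<noteq> w" for i by auto
    then show ?thesis using False by (auto simp: coeff_weight_part)
  qed
  have "coeff (\<sigma> P) w = (\<Sum>j\<le>degree P. \<Sum>i\<le>degree (coeff P j).
      if m * i + n * j = w then smult (coeff (coeff P j) i) (\<phi> ^ i * \<gamma> ^ j) else 0)"
    unfolding hom_eq_sum[of P] coeff_sum \<phi>_\<gamma>_def
    by (intro sum.cong refl coeff_top_weight_monomial deg) (use P in \<open>auto simp: weight_le_def\<close>)
  also have "\<dots> = (\<Sum>j\<le>degree P. coeff (weight_part \<phi> m n w P) j * \<gamma> ^ j)"
    by (simp only: inner)
  also have "\<dots> = poly (weight_part \<phi> m n w P) \<gamma>"
    unfolding coeff_weight_part by (simp only: weight_part_def poly_sum poly_monom)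
  finally show ?thesis by (simp add: \<phi>_\<gamma>_def)
qed

lemma div_gcd_dvd_of_dvd_mult:
  fixes m n k :: nat
  assumes "m > 0" "m dvd n * k"
  shows "m div gcd m n dvd k"
proof -
  obtain a b where ab: "m = a * gcd m n" "n = b * gcd m n" "coprime a b"
    using gcd_coprime_exists[of m n] \<open>m > 0\<close> by auto
  have "a * gcd m n dvd b * gcd m n * k" using assms(2) ab(1,2) by metis
  then have "a dvd b * k" using \<open>m > 0\<close> by (simp add: mult.commute mult.left_commute)
  then have "a dvd k" using ab(3) by (simp add: coprime_dvd_mult_right_iff)
  moreover have "m div gcd m n = a"
    using ab(1) \<open>m > 0\<close> by (metis nonzero_mult_div_cancel_right gcd_eq_0_iff less_irrefl)
  ultimately show ?thesis by simp
qed

lemma weight_part_exponents_congruent: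
  assumes "m > 0" "coeff (weight_part \<phi> m n w P) i \<noteq> 0" "coeff (weight_part \<phi> m n w P) j \<noteq> 0"
  shows "i mod (m div gcd m n) = j mod (m div gcd m n)"
  using assms(2,3)
proof (induction i j rule: linorder_wlog)
  case (le i j)
  have bound: "n * j \<le> w" and dvd: "m dvd w - n * i" "m dvd w - n * j"
    using le.prems by (auto simp: coeff_weight_part split: if_splits)
  have "(w - n * i) - (w - n * j) = n * (j - i)"
    using bound le.hyps by (simp add: algebra_simps diff_mult_distrib2)
  then have "m dvd n * (j - i)" using dvd by (metis dvd_diff_nat)
  then have "m div gcd m n dvd j - i" using div_gcd_dvd_of_dvd_mult[OF \<open>m > 0\<close>] by blast
  then show ?case using le.hyps mod_eq_dvd_iff_nat by metis
qed metis

lemma ex_nonvanishing_weight_part_derivative: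
  fixes P :: "'a::field_char_0 bipoly"
  assumes "m > 0" and nz: "weight_part \<phi> m n w P \<noteq> 0" and "\<gamma> \<noteq> 0"
  obtains q where "poly ((pderiv ^^ q) (weight_part \<phi> m n w P)) \<gamma> \<noteq> 0" "q * lcm m n \<le> w"
proof
  define R where "R = weight_part \<phi> m n w P"
  show "poly ((pderiv ^^ order \<gamma> R) (weight_part \<phi> m n w P)) \<gamma> \<noteq> 0"
    using poly_higher_pderiv_order_nonzero nz by (simp add: R_def)
  have "order \<gamma> R * (m div gcd m n) \<le> degree R"
    unfolding R_def
    using \<open>m > 0\<close> weight_part_exponents_congruent
    by (intro order_mult_le_degree_of_congruent_exponents nz \<open>\<gamma> \<noteq> 0\<close>)
       (auto simp: div_greater_zero_iff gcd_le1_nat)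
  then have "n * (order \<gamma> R * (m div gcd m n)) \<le> n * degree R" by (rule mult_le_mono2)
  moreover have "lcm m n = n * (m div gcd m n)"
    by (simp add: lcm_nat_def div_mult_swap mult.commute)
  moreover have "n * degree R \<le> w"
    using nz leading_coeff_0_iff[of R]
    by (auto simp: R_def coeff_weight_part[of _ _ _ _ _ "degree _"] split: if_splits)
  ultimately show "order \<gamma> R * lcm m n \<le> w" by (metis mult.left_commute order_trans)
qed

lemma tdeg_hom_higher_pderiv_le:
  fixes \<rho> :: "'a::field bipoly \<Rightarrow> 'a bipoly"
  assumes "alg_hom \<rho>" and J: "jacobian (\<rho> bX) (\<rho> bY) \<noteq> 0" and nz: "\<rho> ((pderiv ^^ q) P) \<noteq> 0"
  shows "tdeg (\<rho> ((pderiv ^^ q) P)) + q * (tdeg (jacobian (\<rho> bX) (\<rho> bY)) + 2) \<le> tdeg (\<rho> P) + q * tdeg (\<rho> bX)"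
  using nz
proof (induction q)
  case (Suc q)
  interpret alg_hom \<rho> by fact
  define Q where "Q = (pderiv ^^ q) P"
  have "\<rho> (pderiv Q) \<noteq> 0" using Suc.prems by (simp add: Q_def)
  then have "tdeg (jacobian (\<rho> bX) (\<rho> bY)) + tdeg (\<rho> (pderiv Q)) + 2 \<le> tdeg (\<rho> bX) + tdeg (\<rho> Q)"
    using tdeg_jacobian_le[of "\<rho> bX" "\<rho> Q"] J by (simp add: jacobian_hom_right[OF assms(1), of Q] tdeg_mult)
  moreover have "\<rho> Q \<noteq> 0"
  proof
    assume "\<rho> Q = 0"
    then have "jacobian (\<rho> bX) (\<rho> Q) = 0" by (simp add: jacobian_def inner_pderiv_def)
    then show False using J \<open>\<rho> (pderiv Q) \<noteq> 0\<close> jacobian_hom_right[OF assms(1), of Q] by simp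
  qed
  ultimately show ?case using Suc.IH by (simp add: Q_def)
qed simp

theorem tdeg_hom_lower_bound:
  fixes \<rho> :: "'a::field_char_0 bipoly \<Rightarrow> 'a bipoly"
  assumes "alg_hom \<rho>" and J: "jacobian (\<rho> bX) (\<rho> bY) \<noteq> 0"
  defines "m \<equiv> tdeg (\<rho> bX)" and "n \<equiv> tdeg (\<rho> bY)"
  assumes P: "weight_le m n (m * i + n * j) P" "coeff (coeff P j) i \<noteq> 0"
  obtains q where "q * lcm m n \<le> m * i + n * j"
    "m * i + n * j + q * (tdeg (jacobian (\<rho> bX) (\<rho> bY)) + 2) \<le> tdeg (\<rho> P) + q * (m + n)"
proof -
  interpret alg_hom \<rho> by fact
  define w where "w = m * i + n * j"
  define \<phi> where "\<phi> = lead_form (\<rho> bX)"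
  define \<gamma> where "\<gamma> = lead_form (\<rho> bY)"
  have "m > 0" "n > 0" using tdeg_jacobian_le[OF J] J unfolding m_def n_def
    by (auto simp: tdeg_eq_0_iff jacobian_def intro!: gr0I)
  have "\<phi> \<noteq> 0" "\<gamma> \<noteq> 0" using J by (auto simp: \<phi>_def \<gamma>_def jacobian_def inner_pderiv_def)
  have "coeff (weight_part \<phi> m n w P) j \<noteq> 0"
    using P(2) \<open>m > 0\<close> \<open>\<phi> \<noteq> 0\<close> by (simp add: coeff_weight_part w_def)
  then have "weight_part \<phi> m n w P \<noteq> 0" by auto
  then obtain q where q: "poly ((pderiv ^^ q) (weight_part \<phi> m n w P)) \<gamma> \<noteq> 0" "q * lcm m n \<le> w"
    using ex_nonvanishing_weight_part_derivative \<open>m > 0\<close> \<open>\<gamma> \<noteq> 0\<close> by metis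
  have "n \<le> lcm m n" using \<open>m > 0\<close> \<open>n > 0\<close> by (simp add: dvd_imp_le lcm_pos_nat)
  then have qn: "q * n \<le> w" using q(2) by (meson mult_le_mono2 order_trans)
  define Q where "Q = (pderiv ^^ q) P"
  have "coeff ((blowup \<circ> \<rho>) Q) (w - q * n)
      = poly (weight_part (coeff ((blowup \<circ> \<rho>) bX) m) m n (w - q * n) Q) (coeff ((blowup \<circ> \<rho>) bY) n)"
    unfolding Q_def
    by (rule coeff_top_weight_hom[OF alg_hom_comp[OF blowup.alg_hom_axioms \<open>alg_hom \<rho>\<close>]
          weight_le_higher_pderiv[OF P(1)[folded w_def]] \<open>m > 0\<close>])
       (simp_all add: m_def n_def tdeg_def)
  moreover have "coeff (blowup (\<rho> bX)) m = \<phi>" "coeff (blowup (\<rho> bY)) n = \<gamma>"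
    by (simp_all add: m_def n_def \<phi>_def \<gamma>_def tdeg_def lead_form_def)
  ultimately have "coeff (blowup (\<rho> Q)) (w - q * n) \<noteq> 0"
    using q(1) by (simp add: Q_def weight_part_higher_pderiv[OF qn])
  then have "w - q * n \<le> tdeg (\<rho> Q)" "\<rho> Q \<noteq> 0"
    by (auto simp: tdeg_def intro: le_degree)
  then show ?thesis
    using tdeg_hom_higher_pderiv_le[OF \<open>alg_hom \<rho>\<close> J, of q P] q(2) qn
    by (intro that[of q]) (auto simp: Q_def w_def m_def n_def algebra_simps)
qed

lemma dvd_of_lcm_less_add:
  fixes m n :: nat
  assumes "m > 0" "n > 0" "lcm m n < m + n"
  shows "m dvd n \<or> n dvd m"
proof (rule ccontr)
  assume "\<not> (m dvd n \<or> n dvd m)"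
  then have ne: "lcm m n \<noteq> m" "lcm m n \<noteq> n" by (metis dvd_lcm2, metis dvd_lcm1)
  have "2 * k \<le> l" if dvd: "k dvd l" and "l \<noteq> k" "l > 0" for k l :: nat
  proof -
    obtain r where "l = k * r" using dvd ..
    then have "r \<noteq> 0" "r \<noteq> 1" using that by auto
    then show ?thesis using \<open>l = k * r\<close> by simp
  qed
  from this[of m "lcm m n"] this[of n "lcm m n"] ne show False
    using assms by (simp add: lcm_pos_nat)
qed

lemma tdeg_aut_dvd:
  fixes \<rho> :: "'a::field_char_0 bipoly \<Rightarrow> 'a bipoly"
  assumes \<rho>: "is_K_algebra_aut \<rho>"
  shows "tdeg (\<rho> bX) dvd tdeg (\<rho> bY) \<or> tdeg (\<rho> bY) dvd tdeg (\<rho> bX)"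
proof -
  define m n where "m = tdeg (\<rho> bX)" "n = tdeg (\<rho> bY)"
  have pos: "m > 0" "n > 0" using tdeg_aut_pos[OF \<rho>] by (auto simp: m_n_def)
  define P where "P = inv \<rho> bX"
  have \<rho>P: "\<rho> P = bX" by (simp add: P_def aut_inv_apply_right[OF \<rho>])
  obtain c where c: "c \<noteq> 0" "jacobian (\<rho> bX) (\<rho> bY) = bconst c" using jacobian_aut[OF \<rho>] .
  have "tdeg P > 0" unfolding P_def by (rule tdeg_aut_pos[OF aut_inv[OF \<rho>]])
  then obtain i' j' where nonconst: "coeff (coeff P j') i' \<noteq> 0" "i' + j' > 0"
    using tdeg_le_iff[of P 0] by auto
  then have "P \<noteq> 0" by auto
  then obtain i j where ij: "coeff (coeff P j) i \<noteq> 0" "weight_le m n (m * i + n * j) P"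
    by (rule ex_weight)
  have J: "jacobian (\<rho> bX) (\<rho> bY) \<noteq> 0" using c by simp
  obtain q where "q * lcm m n \<le> m * i + n * j"
    "m * i + n * j + q * (tdeg (jacobian (\<rho> bX) (\<rho> bY)) + 2) \<le> tdeg (\<rho> P) + q * (m + n)"
    by (rule tdeg_hom_lower_bound[OF aut_alg_hom[OF \<rho>] J, folded m_n_def, OF ij(2,1)])
  then have q: "q * lcm m n \<le> m * i + n * j" "m * i + n * j + q * 2 \<le> 1 + q * (m + n)"
    using c by (simp_all add: \<rho>P)
  have "m dvd n \<or> n dvd m"
  proof (cases "q = 0")
    case True
    have "m * i' + n * j' \<le> m * i + n * j" using ij(2) nonconst(1) unfolding weight_le_def by blast
    then have "m * i' + n * j' \<le> 1" using q(2) True by simp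
    then have "m = 1 \<or> n = 1" using nonconst(2) pos by (cases i'; cases j') auto
    then show ?thesis by auto
  next
    case False
    then have "q * lcm m n < q * (m + n)" using q by linarith
    then show ?thesis using dvd_of_lcm_less_add pos by simp
  qed
  then show ?thesis by (simp add: m_n_def)
qed

section \<open>Jung's theorem\<close>

fun swap_prod :: "('a::field bipoly \<Rightarrow> 'a bipoly) list \<Rightarrow> 'a bipoly \<Rightarrow> 'a bipoly" where
  "swap_prod [] = id"
| "swap_prod (\<beta> # \<beta>s) = \<beta> \<circ> bswap \<circ> swap_prod \<beta>s"

lemma swap_prod_append: "swap_prod (xs @ ys) = swap_prod xs \<circ> swap_prod ys"
  by (induction xs) (simp_all add: comp_assoc)

lemma aut_swap_prod: "\<forall>\<beta>\<in>set \<beta>s. triangular \<beta> \<Longrightarrow> is_K_algebra_aut (swap_prod \<beta>s)"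
  by (induction \<beta>s) (simp_all add: aut_id aut_comp aut_bswap aut_triangular)

definition tame_word :: "nat \<Rightarrow> ('a::field bipoly \<Rightarrow> 'a bipoly) \<Rightarrow> bool" where
  "tame_word n \<rho> \<longleftrightarrow>
     (\<exists>\<beta>s \<beta>. length \<beta>s = n \<and> (\<forall>\<beta>\<in>set \<beta>s. triangular \<beta>) \<and> triangular \<beta> \<and> \<rho> = swap_prod \<beta>s \<circ> \<beta>)"

definition tame :: "('a::field bipoly \<Rightarrow> 'a bipoly) \<Rightarrow> bool" where
  "tame \<rho> \<longleftrightarrow> (\<exists>n. tame_word n \<rho>)"

lemma tame_wordI:
  "\<forall>\<beta>\<in>set \<beta>s. triangular \<beta> \<Longrightarrow> triangular \<beta> \<Longrightarrow> tame_word (length \<beta>s) (swap_prod \<beta>s \<circ> \<beta>)"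
  by (auto simp: tame_word_def)

lemma tame_word_0_iff: "tame_word 0 \<rho> \<longleftrightarrow> triangular \<rho>"
  by (auto simp: tame_word_def)

lemma tame_word_comp_triangular: "tame_word n \<rho> \<Longrightarrow> triangular \<beta> \<Longrightarrow> tame_word n (\<rho> \<circ> \<beta>)"
  unfolding tame_word_def by (metis comp_assoc triangular_comp)

lemma tame_word_comp_bswap:
  assumes "tame_word n \<rho>"
  shows "tame_word (Suc n) (\<rho> \<circ> bswap)"
proof -
  obtain \<beta>s \<beta> where "length \<beta>s = n" "\<forall>\<beta>\<in>set \<beta>s. triangular \<beta>" "triangular \<beta>" "\<rho> = swap_prod \<beta>s \<circ> \<beta>"
    using assms by (auto simp: tame_word_def)
  then show ?thesis
    using tame_wordI[of "\<beta>s @ [\<beta>]" id] by (simp add: swap_prod_append triangular_id comp_assoc ball_Un)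
qed

lemma tame_triangular: "triangular \<beta> \<Longrightarrow> tame \<beta>"
  using tame_word_0_iff by (auto simp: tame_def)

lemma tame_cancel_bswap:
  assumes "tame (\<rho> \<circ> bswap)"
  shows "tame \<rho>"
proof -
  obtain n where "tame_word n (\<rho> \<circ> bswap)" using assms by (auto simp: tame_def)
  then have "tame_word (Suc n) (\<rho> \<circ> bswap \<circ> bswap)" by (rule tame_word_comp_bswap)
  then show ?thesis by (auto simp: tame_def comp_assoc bswap_comp_bswap)
qed

lemma tame_cancel_triangular:
  assumes "tame (\<rho> \<circ> \<beta>)" "triangular \<beta>"
  shows "tame \<rho>"
proof -
  have "\<rho> \<circ> \<beta> \<circ> inv \<beta> = \<rho>"
    by (simp add: fun_eq_iff aut_inv_apply_right[OF aut_triangular[OF assms(2)]])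
  then show ?thesis
    using assms tame_word_comp_triangular triangular_inv by (metis tame_def)
qed

lemma tdeg_le_1_eq:
  assumes "tdeg f \<le> 1"
  shows "f = [:[:coeff (coeff f 0) 0, coeff (coeff f 0) 1:], [:coeff (coeff f 1) 0:]:]"
proof (intro poly_eqI)
  fix i j
  have "coeff (coeff f j) i = 0" if "i + j > 1"
    using assms that tdeg_leD[of f j i] by fastforce
  moreover consider "j = 0" "i = 0" | "j = 0" "i = 1" | "j = 1" "i = 0" | "i + j > 1" by linarith
  ultimately show "coeff (coeff f j) i
      = coeff (coeff [:[:coeff (coeff f 0) 0, coeff (coeff f 0) 1:], [:coeff (coeff f 1) 0:]:] j) i"
    by cases (auto simp: coeff_pCons split: nat.splits)
qed

lemma triangular_of_tdeg_le_1:
  assumes \<rho>: "is_K_algebra_aut \<rho>" and deg: "tdeg (\<rho> bX) \<le> 1" "tdeg (\<rho> bY) \<le> 1"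
    and "coeff (coeff (\<rho> bX) 1) 0 = 0"
  shows "triangular \<rho>"
proof -
  obtain \<gamma> \<alpha> where X: "\<rho> bX = [:[:\<gamma>, \<alpha>:]:]"
    using tdeg_le_1_eq[OF deg(1)] assms(4) by auto
  obtain \<delta> p where Y: "\<rho> bY = [:p, [:\<delta>:]:]"
    using tdeg_le_1_eq[OF deg(2)] by blast
  have "\<rho> = triangular_map \<alpha> \<gamma> \<delta> p"
    using alg_hom_eq_bsubst[OF aut_alg_hom[OF \<rho>]] by (simp add: X Y triangular_map_def)
  moreover have "\<alpha> \<noteq> 0" using aut_generators_not_const(1)[OF \<rho>, of \<gamma>] X by (auto simp: bconst_def)
  moreover have "\<delta> \<noteq> 0" using aut_not_univariate[OF \<rho> X, of p] Y by auto
  ultimately show ?thesis by (simp add: triangularI)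
qed

lemma tame_of_tdeg_le_1:
  assumes \<rho>: "is_K_algebra_aut \<rho>" and deg: "tdeg (\<rho> bX) \<le> 1" "tdeg (\<rho> bY) \<le> 1"
  shows "tame \<rho>"
proof (cases "coeff (coeff (\<rho> bX) 1) 0 = 0")
  case True
  then show ?thesis using triangular_of_tdeg_le_1[OF assms] tame_triangular by blast
next
  case False
  interpret alg_hom \<rho> using \<rho> by (rule aut_alg_hom)
  define c where "c = coeff (coeff (\<rho> bY) 1) 0 / coeff (coeff (\<rho> bX) 1) 0"
  define \<beta> where "\<beta> = triangular_map 1 0 1 [:0, - c:]"
  have \<beta>: "triangular \<beta>" unfolding \<beta>_def by (rule triangularI) simp_all
  define \<sigma> where "\<sigma> = \<rho> \<circ> \<beta> \<circ> bswap"
  have X: "\<sigma> bX = \<rho> bY - smult [:c:] (\<rho> bX)" and Y: "\<sigma> bY = \<rho> bX"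
    by (simp_all add: \<sigma>_def \<beta>_def hom_affine hom_affine_X) (simp add: bconst_def flip: smult_minus_left)
  have "is_K_algebra_aut \<sigma>"
    unfolding \<sigma>_def by (intro aut_comp \<rho> aut_triangular \<beta> aut_bswap)
  moreover have "tdeg (smult [:c:] (\<rho> bX)) \<le> 1"
    using deg(1) unfolding tdeg_le_iff by simp
  then have "tdeg (\<sigma> bX) \<le> 1" unfolding X by (rule tdeg_diff_le[OF deg(2)])
  moreover have "coeff (coeff (\<sigma> bX) 1) 0 = 0" using False by (simp add: X c_def)
  ultimately have "triangular \<sigma>" using deg(1) Y by (intro triangular_of_tdeg_le_1) simp_all
  then have "tame (\<rho> \<circ> \<beta>)"
    unfolding \<sigma>_def by (rule tame_cancel_bswap[OF tame_triangular])
  then show ?thesis using \<beta> by (rule tame_cancel_triangular)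
qed

lemma ex_triangular_reducing_tdeg:
  fixes \<rho> :: "'a::field_char_0 bipoly \<Rightarrow> 'a bipoly"
  assumes \<rho>: "is_K_algebra_aut \<rho>" and dvd: "tdeg (\<rho> bX) dvd tdeg (\<rho> bY)"
    and big: "tdeg (\<rho> bX) + tdeg (\<rho> bY) > 2"
  obtains \<beta> where "triangular \<beta>" "\<rho> (\<beta> bX) = \<rho> bX" "tdeg (\<rho> (\<beta> bY)) < tdeg (\<rho> bY)"
proof -
  interpret alg_hom \<rho> using \<rho> by (rule aut_alg_hom)
  obtain k where k: "tdeg (\<rho> bY) = k * tdeg (\<rho> bX)" using dvd by (metis dvd_def mult.commute)
  obtain b where "jacobian (\<rho> bX) (\<rho> bY) = bconst b" using jacobian_aut[OF \<rho>] by blast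
  then obtain c where c: "tdeg (\<rho> bY - bconst c * \<rho> bX ^ k) < tdeg (\<rho> bY)"
    using ex_power_reducing_tdeg[OF tdeg_aut_pos[OF \<rho>] k] big by auto
  define \<beta> where "\<beta> = triangular_map 1 0 1 (monom (- c) k)"
  have "[:monom (- c) k:] = - (bconst c * bX ^ k)"
    by (simp add: bconst_def bX_def const_poly_power monom_altdef)
  moreover have "\<beta> bY = bY + [:monom (- c) k:]"
    by (simp add: \<beta>_def) (simp add: bY_def one_pCons)
  ultimately have "\<beta> bY = bY - bconst c * bX ^ k" by simp
  moreover have "\<beta> bX = bX" by (simp add: \<beta>_def) (simp add: bX_def)
  moreover have "triangular \<beta>" unfolding \<beta>_def by (rule triangularI) simp_all
  ultimately show ?thesis using that c by simp
qed

theorem tame_aut: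
  fixes \<rho> :: "'a::field_char_0 bipoly \<Rightarrow> 'a bipoly"
  assumes "is_K_algebra_aut \<rho>"
  shows "tame \<rho>"
  using assms
proof (induction "tdeg (\<rho> bX) + tdeg (\<rho> bY)" arbitrary: \<rho> rule: less_induct)
  case less
  show ?case
  proof (cases "tdeg (\<rho> bX) + tdeg (\<rho> bY) > 2")
    case True
    have reduce: "tame \<sigma>"
      if \<sigma>: "is_K_algebra_aut \<sigma>" "tdeg (\<sigma> bX) + tdeg (\<sigma> bY) = tdeg (\<rho> bX) + tdeg (\<rho> bY)"
        and dvd: "tdeg (\<sigma> bX) dvd tdeg (\<sigma> bY)" for \<sigma> :: "'a bipoly \<Rightarrow> 'a bipoly"
    proof -
      have "tdeg (\<sigma> bX) + tdeg (\<sigma> bY) > 2" using True \<sigma>(2) by simp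
      then obtain \<beta> where \<beta>: "triangular \<beta>" "\<sigma> (\<beta> bX) = \<sigma> bX" "tdeg (\<sigma> (\<beta> bY)) < tdeg (\<sigma> bY)"
        using ex_triangular_reducing_tdeg[OF \<sigma>(1) dvd] by metis
      then have "tame (\<sigma> \<circ> \<beta>)"
        using \<sigma>(2) by (intro less.hyps aut_comp[OF \<sigma>(1)] aut_triangular) simp_all
      then show ?thesis using \<beta>(1) by (rule tame_cancel_triangular)
    qed
    from tdeg_aut_dvd[OF less.prems] show ?thesis
    proof
      assume "tdeg (\<rho> bX) dvd tdeg (\<rho> bY)"
      then show ?thesis using reduce[OF less.prems] by simp
    next
      assume "tdeg (\<rho> bY) dvd tdeg (\<rho> bX)"
      then have "tame (\<rho> \<circ> bswap)"
        by (intro reduce aut_comp less.prems aut_bswap) simp_all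
      then show ?thesis by (rule tame_cancel_bswap)
    qed
  next
    case False
    then show ?thesis using tdeg_aut_pos[OF less.prems] by (intro tame_of_tdeg_le_1 less.prems) simp_all
  qed
qed

section \<open>The normal form of Friedland and Milnor up to conjugacy\<close>

definition conjugate :: "('a::field bipoly \<Rightarrow> 'a bipoly) \<Rightarrow> ('a bipoly \<Rightarrow> 'a bipoly) \<Rightarrow> bool" where
  "conjugate \<rho> \<sigma> \<longleftrightarrow> (\<exists>\<kappa>. is_K_algebra_aut \<kappa> \<and> \<kappa> \<circ> \<sigma> = \<rho> \<circ> \<kappa>)"

lemma conjugateI: "is_K_algebra_aut \<kappa> \<Longrightarrow> \<kappa> \<circ> \<sigma> = \<rho> \<circ> \<kappa> \<Longrightarrow> conjugate \<rho> \<sigma>"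
  by (auto simp: conjugate_def)

lemma conjugate_refl: "conjugate \<rho> \<rho>"
  by (rule conjugateI[OF aut_id]) simp

lemma conjugate_trans [trans]:
  assumes "conjugate \<rho> \<sigma>" "conjugate \<sigma> \<tau>"
  shows "conjugate \<rho> \<tau>"
proof -
  obtain \<kappa> \<mu> where "is_K_algebra_aut \<kappa>" "\<kappa> \<circ> \<sigma> = \<rho> \<circ> \<kappa>" "is_K_algebra_aut \<mu>" "\<mu> \<circ> \<tau> = \<sigma> \<circ> \<mu>"
    using assms by (auto simp: conjugate_def)
  then show ?thesis
    by (intro conjugateI[of "\<kappa> \<circ> \<mu>"] aut_comp) (simp_all add: comp_assoc, metis comp_assoc)
qed

lemma conjugate_comp_commute:
  assumes "is_K_algebra_aut \<kappa>"
  shows "conjugate (\<kappa> \<circ> \<sigma>) (\<sigma> \<circ> \<kappa>)"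
  by (rule conjugateI[OF assms]) (simp add: comp_assoc)

definition shear_degree :: "('a::field bipoly \<Rightarrow> 'a bipoly) \<Rightarrow> nat" where
  "shear_degree \<beta> = degree (coeff (\<beta> bY) 0)"

lemma shear_degree_triangular_map [simp]: "shear_degree (triangular_map \<alpha> \<gamma> \<delta> p) = degree p"
  by (simp add: shear_degree_def)

lemma triangular_shear_degree_le_1E:
  assumes "triangular \<beta>" "shear_degree \<beta> \<le> 1"
  obtains \<alpha> \<gamma> \<delta> a b where "\<alpha> \<noteq> 0" "\<delta> \<noteq> 0" "\<beta> = triangular_map \<alpha> \<gamma> \<delta> [:b, a:]"
proof -
  obtain \<alpha> \<gamma> \<delta> p where \<beta>: "\<alpha> \<noteq> 0" "\<delta> \<noteq> 0" "\<beta> = triangular_map \<alpha> \<gamma> \<delta> p"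
    using assms(1) by (auto simp: triangular_def)
  moreover have "p = [:coeff p 0, coeff p 1:]"
    using assms(2) \<beta>(3) by (intro poly_eqI) (auto simp: coeff_pCons coeff_eq_0 split: nat.splits)
  ultimately show ?thesis using that by metis
qed

text \<open>The Bruhat decomposition of an affine automorphism that is not triangular.\<close>
lemma swap_affine_swap:
  assumes "a \<noteq> (0 :: 'a::field)"
  shows "bswap \<circ> triangular_map \<alpha> \<gamma> \<delta> [:b, a:] \<circ> bswap
    = triangular_map 1 0 a [:b, \<delta>:] \<circ> bswap \<circ> triangular_map 1 0 (- \<alpha> * \<delta> / a) [:\<gamma> - \<alpha> * b / a, \<alpha> / a:]"
  by (rule alg_hom_eqI)
     (use assms in \<open>simp_all add: alg_hom_comp triangular_map.alg_hom_axioms bswap.alg_hom_axioms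
        bswap.hom_affine bswap.hom_affine_X,
      simp_all add: bconst_def bX_def bY_def field_simps\<close>)

lemma tame_word_comp_swap_affine_swap:
  assumes \<rho>: "tame_word n \<rho>" and "triangular \<beta>" "shear_degree \<beta> \<le> 1"
  obtains m where "m \<le> Suc n" "tame_word m (\<rho> \<circ> (bswap \<circ> \<beta> \<circ> bswap))"
proof -
  obtain \<alpha> \<gamma> \<delta> a b where nz: "\<alpha> \<noteq> 0" "\<delta> \<noteq> 0" and \<beta>: "\<beta> = triangular_map \<alpha> \<gamma> \<delta> [:b, a:]"
    using assms(2,3) by (rule triangular_shear_degree_le_1E)
  show ?thesis
  proof (cases "a = 0")
    case True
    have "bswap \<circ> \<beta> \<circ> bswap = triangular_map \<delta> b \<alpha> [:\<gamma>:]"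
      unfolding \<beta> True
      by (rule alg_hom_eqI)
         (simp_all add: alg_hom_comp triangular_map.alg_hom_axioms bswap.alg_hom_axioms
            bswap.hom_affine[of _ 0, simplified] bswap.hom_affine_X, simp_all add: bconst_def bX_def bY_def)
    then show ?thesis
      using that[of n] tame_word_comp_triangular[OF \<rho>] nz by (simp add: triangularI)
  next
    case False
    have "\<rho> \<circ> (bswap \<circ> \<beta> \<circ> bswap) = \<rho> \<circ> triangular_map 1 0 a [:b, \<delta>:] \<circ> bswap
        \<circ> triangular_map 1 0 (- \<alpha> * \<delta> / a) [:\<gamma> - \<alpha> * b / a, \<alpha> / a:]"
      unfolding \<beta> swap_affine_swap[OF False] by (simp only: comp_assoc)
    moreover have "tame_word (Suc n) \<dots>"
      by (intro tame_word_comp_triangular tame_word_comp_bswap \<rho> triangularI) (use False nz in simp_all)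
    ultimately show ?thesis using that[of "Suc n"] by simp
  qed
qed

lemma affine_conjugate_triangular:
  fixes \<beta> :: "'a::alg_closed_field bipoly \<Rightarrow> 'a bipoly"
  assumes "triangular \<beta>" "shear_degree \<beta> \<le> 1"
  obtains \<sigma> where "conjugate (\<beta> \<circ> bswap) \<sigma>" "triangular \<sigma>"
proof -
  obtain \<alpha> \<gamma> \<delta> a b where nz: "\<alpha> \<noteq> 0" "\<delta> \<noteq> 0" and \<beta>: "\<beta> = triangular_map \<alpha> \<gamma> \<delta> [:b, a:]"
    using assms by (rule triangular_shear_degree_le_1E)
  \<comment> \<open>The form \<open>x + s y\<close> is an eigenvector of the linear part of \<open>\<beta> \<circ> bswap\<close>.\<close>
  obtain s where "poly [:- \<delta>, a, \<alpha>:] s = 0"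
    using alg_closed_imp_poly_has_root[of "[:- \<delta>, a, \<alpha>:]"] nz by auto
  then have s: "(a + s * \<alpha>) * s = \<delta>" by (simp add: algebra_simps)
  then have "a + s * \<alpha> \<noteq> 0" "s \<noteq> 0" using nz by auto
  define \<kappa> where "\<kappa> = bswap \<circ> triangular_map 1 0 1 [:0, s:] \<circ> bswap"
  define \<sigma> where "\<sigma> = triangular_map (a + s * \<alpha>) (b + s * \<gamma>) (- \<alpha> * s) [:\<gamma>, \<alpha>:]"
  have \<kappa>: "is_K_algebra_aut \<kappa>"
    unfolding \<kappa>_def by (intro aut_comp aut_bswap aut_triangular triangularI) simp_all
  interpret \<kappa>: alg_hom \<kappa> using \<kappa> by (rule aut_alg_hom)
  have \<kappa>_X: "\<kappa> bX = bX + bconst s * bY" and \<kappa>_Y: "\<kappa> bY = bY"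
    by (simp_all add: \<kappa>_def bswap.hom_affine bswap.hom_affine_X)
  have "\<kappa> \<circ> \<sigma> = (\<beta> \<circ> bswap) \<circ> \<kappa>"
  proof (rule alg_hom_eqI)
    show "(\<kappa> \<circ> \<sigma>) bX = ((\<beta> \<circ> bswap) \<circ> \<kappa>) bX"
      by (simp add: \<sigma>_def \<beta> \<kappa>_X \<kappa>.hom_affine_X flip: s) (simp add: bconst_def bX_def bY_def algebra_simps)
    show "(\<kappa> \<circ> \<sigma>) bY = ((\<beta> \<circ> bswap) \<circ> \<kappa>) bY"
      by (simp add: \<sigma>_def \<beta> \<kappa>_X \<kappa>_Y \<kappa>.hom_affine) (simp add: bconst_def bX_def bY_def)
  qed (simp_all add: \<sigma>_def \<beta> alg_hom_comp \<kappa>.alg_hom_axioms triangular_map.alg_hom_axioms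
      bswap.alg_hom_axioms)
  moreover have "triangular \<sigma>"
    unfolding \<sigma>_def using nz \<open>a + s * \<alpha> \<noteq> 0\<close> \<open>s \<noteq> 0\<close> by (intro triangularI) simp_all
  ultimately show ?thesis using that conjugateI[OF \<kappa>] by blast
qed

definition henon_factor :: "('a::field bipoly \<Rightarrow> 'a bipoly) \<Rightarrow> bool" where
  "henon_factor \<beta> \<longleftrightarrow> triangular \<beta> \<and> shear_degree \<beta> \<ge> 2"

definition henon_word :: "('a::field bipoly \<Rightarrow> 'a bipoly) list \<Rightarrow> bool" where
  "henon_word \<beta>s \<longleftrightarrow> \<beta>s \<noteq> [] \<and> (\<forall>\<beta>\<in>set \<beta>s. henon_factor \<beta>)"

lemma swap_prod_conjugate_shorter_tame_word:
  fixes \<beta>s :: "('a::alg_closed_field bipoly \<Rightarrow> 'a bipoly) list"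
  assumes tri: "\<forall>\<beta>\<in>set \<beta>s. triangular \<beta>" and "\<beta>s \<noteq> []" "\<not> henon_word \<beta>s"
  obtains m \<sigma> where "m < length \<beta>s" "tame_word m \<sigma>" "conjugate (swap_prod \<beta>s) \<sigma>"
proof -
  obtain \<beta> where "\<beta> \<in> set \<beta>s" and deg: "shear_degree \<beta> \<le> 1"
    using assms by (force simp: henon_word_def henon_factor_def)
  then obtain xs ys where \<beta>s: "\<beta>s = xs @ \<beta> # ys" by (auto simp: in_set_conv_decomp)
  have \<beta>: "triangular \<beta>" and xs: "\<forall>\<beta>\<in>set xs. triangular \<beta>" and ys_xs: "\<forall>\<beta>\<in>set (ys @ xs). triangular \<beta>"
    using tri \<beta>s by auto
  have rotate: "conjugate (swap_prod \<beta>s) (swap_prod (\<beta> # ys @ xs))"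
    using conjugate_comp_commute[OF aut_swap_prod[OF xs], of "swap_prod (\<beta> # ys)"]
    by (simp add: \<beta>s swap_prod_append comp_assoc)
  show ?thesis
  proof (cases "ys @ xs" rule: rev_cases)
    case Nil
    then have "conjugate (swap_prod \<beta>s) (\<beta> \<circ> bswap)" using rotate by simp
    moreover obtain \<sigma> where "conjugate (\<beta> \<circ> bswap) \<sigma>" "triangular \<sigma>"
      using affine_conjugate_triangular[OF \<beta> deg] .
    ultimately show ?thesis
      using that[of 0 \<sigma>] conjugate_trans \<open>\<beta>s \<noteq> []\<close> by (simp add: tame_word_0_iff) blast
  next
    case (snoc us \<epsilon>)
    note rotate
    also have "conjugate (swap_prod (\<beta> # ys @ xs)) (swap_prod us \<circ> \<epsilon> \<circ> (bswap \<circ> \<beta> \<circ> bswap))"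
      using conjugate_comp_commute[OF aut_comp[OF aut_triangular[OF \<beta>] aut_bswap],
          of "swap_prod us \<circ> \<epsilon> \<circ> bswap"]
      by (simp add: snoc swap_prod_append comp_assoc)
    finally have conj: "conjugate (swap_prod \<beta>s) (swap_prod us \<circ> \<epsilon> \<circ> (bswap \<circ> \<beta> \<circ> bswap))" .
    have "tame_word (length us) (swap_prod us \<circ> \<epsilon>)"
      using ys_xs snoc by (intro tame_wordI) simp_all
    then obtain m where "m \<le> Suc (length us)" "tame_word m (swap_prod us \<circ> \<epsilon> \<circ> (bswap \<circ> \<beta> \<circ> bswap))"
      using tame_word_comp_swap_affine_swap \<beta> deg by metis
    moreover have "length \<beta>s = Suc (Suc (length us))"
      using arg_cong[OF snoc, of length] by (simp add: \<beta>s)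
    ultimately show ?thesis using that conj by (metis less_Suc_eq_le)
  qed
qed

lemma tame_word_conjugate_triangular_or_henon:
  fixes \<rho> :: "'a::alg_closed_field bipoly \<Rightarrow> 'a bipoly"
  assumes "tame_word n \<rho>"
  shows "\<exists>\<sigma>. conjugate \<rho> \<sigma> \<and> (triangular \<sigma> \<or> (\<exists>\<beta>s. henon_word \<beta>s \<and> \<sigma> = swap_prod \<beta>s))"
  using assms
proof (induction n arbitrary: \<rho> rule: less_induct)
  case (less n)
  obtain \<beta>s \<beta> where \<beta>s: "length \<beta>s = n" "\<forall>\<beta>\<in>set \<beta>s. triangular \<beta>" and \<beta>: "triangular \<beta>"
    and \<rho>: "\<rho> = swap_prod \<beta>s \<circ> \<beta>"
    using less.prems by (auto simp: tame_word_def)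
  show ?case
  proof (cases \<beta>s)
    case Nil
    then show ?thesis using \<beta> \<rho> conjugate_refl by auto
  next
    case (Cons \<beta>' \<beta>s')
    define \<gamma>s where "\<gamma>s = (\<beta> \<circ> \<beta>') # \<beta>s'"
    have conj: "conjugate \<rho> (swap_prod \<gamma>s)"
      unfolding \<rho> using conjugate_comp_commute[OF aut_swap_prod[OF \<beta>s(2)], of \<beta>]
      by (simp add: \<gamma>s_def Cons comp_assoc)
    show ?thesis
    proof (cases "henon_word \<gamma>s")
      case True
      then show ?thesis using conj by blast
    next
      case False
      have "\<forall>\<beta>\<in>set \<gamma>s. triangular \<beta>" "\<gamma>s \<noteq> []"
        using \<beta> \<beta>s(2) Cons by (auto simp: \<gamma>s_def intro: triangular_comp)
      then obtain m \<sigma> where \<sigma>: "m < length \<gamma>s" "tame_word m \<sigma>" "conjugate (swap_prod \<gamma>s) \<sigma>"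
        using False by (rule swap_prod_conjugate_shorter_tame_word)
      then have "m < n" using \<beta>s(1) Cons by (simp add: \<gamma>s_def)
      then show ?thesis using less.IH \<sigma>(2,3) conj conjugate_trans by meson
    qed
  qed
qed

theorem aut_conjugate_triangular_or_henon:
  fixes \<rho> :: "'a::{alg_closed_field, field_char_0} bipoly \<Rightarrow> 'a bipoly"
  assumes "is_K_algebra_aut \<rho>"
  obtains \<sigma> where "conjugate \<rho> \<sigma>" "triangular \<sigma> \<or> (\<exists>\<beta>s. henon_word \<beta>s \<and> \<sigma> = swap_prod \<beta>s)"
  using tame_aut[OF assms] tame_word_conjugate_triangular_or_henon unfolding tame_def by metis

section \<open>Leading forms of compositions of generalised Henon maps\<close>

lemma hom_const_poly_lead_form:
  fixes p :: "'a::idom poly"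
  assumes "alg_hom \<sigma>" "tdeg (\<sigma> bX) > 0"
  shows "tdeg (\<sigma> [:p:]) = degree p * tdeg (\<sigma> bX)"
    and "lead_form (\<sigma> [:p:]) = [:lead_coeff p:] * lead_form (\<sigma> bX) ^ degree p"
proof -
  have blowup: "blowup (\<sigma> [:p:]) = pcompose (map_poly (\<lambda>c. [:c:]) p) (blowup (\<sigma> bX))"
    using alg_hom.hom_const_poly[OF alg_hom_comp[OF blowup.alg_hom_axioms assms(1)], of p] by simp
  have deg: "degree (map_poly (\<lambda>c. [:c:]) p) = degree p" by (rule degree_map_poly) simp
  show "tdeg (\<sigma> [:p:]) = degree p * tdeg (\<sigma> bX)"
    by (simp add: tdeg_def blowup degree_pcompose deg)
  show "lead_form (\<sigma> [:p:]) = [:lead_coeff p:] * lead_form (\<sigma> bX) ^ degree p"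
    using assms(2) unfolding lead_form_def blowup tdeg_def
    by (simp only: lead_coeff_comp deg) (simp add: coeff_map_poly)
qed

definition x_dominant :: "'a::comm_ring_1 bipoly \<Rightarrow> bool" where
  "x_dominant f \<longleftrightarrow> (\<exists>c. c \<noteq> 0 \<and> lead_form f = [:c:])"

lemma x_dominant_X: "x_dominant bX"
  by (simp add: x_dominant_def lead_form_def) (simp add: bY_def one_pCons)

lemma x_dominant_add_right: "x_dominant g \<Longrightarrow> tdeg f < tdeg g \<Longrightarrow> x_dominant (f + g)"
  by (simp add: x_dominant_def tdeg_add_eq_right)

lemma x_dominant_scale: "x_dominant f \<Longrightarrow> c \<noteq> 0 \<Longrightarrow> x_dominant (bconst c * f)" for f :: "'a::idom bipoly"
  by (auto simp: x_dominant_def lead_form_mult)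

lemma x_dominant_hom_const_poly:
  fixes p :: "'a::idom poly"
  assumes "alg_hom \<sigma>" "tdeg (\<sigma> bX) > 0" "x_dominant (\<sigma> bX)" "p \<noteq> 0"
  shows "x_dominant (\<sigma> [:p:])"
  using assms by (auto simp: x_dominant_def hom_const_poly_lead_form const_poly_power)

lemma lead_form_of_x_dominant_bswap:
  assumes "x_dominant (bswap f)"
  obtains c where "c \<noteq> 0" "lead_form f = monom c (tdeg f)"
proof -
  obtain c where c: "c \<noteq> 0" "lead_form (bswap f) = [:c:]" using assms by (auto simp: x_dominant_def)
  have form: "coeff (lead_form g) j = (if j \<le> tdeg g then coeff (coeff g j) (tdeg g - j) else 0)"
    for g :: "'a bipoly" and j
    by (simp add: lead_form_def tdeg_def coeff_blowup)
  have "lead_form f = monom c (tdeg f)"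
  proof (rule poly_eqI)
    fix j
    have "coeff (lead_form f) j = (if j \<le> tdeg f then coeff (lead_form (bswap f)) (tdeg f - j) else 0)"
      by (simp add: form coeff_bswap)
    then show "coeff (lead_form f) j = coeff (monom c (tdeg f)) j"
      by (auto simp: c coeff_pCons split: nat.splits)
  qed
  then show ?thesis using c(1) that by blast
qed

lemma prod_list_map_pos:
  fixes f :: "'b \<Rightarrow> nat"
  shows "\<forall>x\<in>set xs. f x > 0 \<Longrightarrow> prod_list (map f xs) > 0"
  by (induction xs) simp_all

lemma ex_balanced_prod_split_append:
  fixes f :: "'b \<Rightarrow> nat"
  assumes "\<forall>x\<in>set (as @ bs). f x > 0" "prod_list (map f (butlast as)) < prod_list (map f bs)"
  obtains as' b bs' where "as @ bs = as' @ b # bs'" "prod_list (map f bs') \<le> prod_list (map f as')"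
    "prod_list (map f (butlast as')) < f b * prod_list (map f bs')"
  using assms
proof (induction bs arbitrary: as thesis)
  case Nil
  then have "\<forall>x\<in>set (butlast as). f x > 0" by (auto dest: in_set_butlastD)
  then show ?case using prod_list_map_pos[of "butlast as" f] Nil.prems(3) by simp
next
  case (Cons b bs)
  show ?case
  proof (cases "prod_list (map f bs) \<le> prod_list (map f as)")
    case True
    then show ?thesis using Cons.prems(1,3) by auto
  next
    case False
    show ?thesis by (rule Cons.IH[of "as @ [b]"]) (use False Cons.prems in simp_all)
  qed
qed

lemma ex_balanced_prod_split:
  fixes f :: "'b \<Rightarrow> nat"
  assumes "xs \<noteq> []" "\<forall>x\<in>set xs. f x \<ge> 2"
  obtains as b bs where "xs = as @ b # bs" "prod_list (map f bs) \<le> prod_list (map f as)"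
    "prod_list (map f (butlast as)) < f b * prod_list (map f bs)"
proof -
  have pos: "\<forall>x\<in>set xs. f x > 0" using assms(2) by force
  obtain y ys where xs: "xs = y # ys" using assms(1) by (cases xs) auto
  have "2 * 1 \<le> f y * prod_list (map f ys)"
    using assms(2) pos prod_list_map_pos[of ys f] by (intro mult_le_mono) (simp_all add: xs Suc_le_eq)
  then have "prod_list (map f (butlast [])) < prod_list (map f xs)" by (simp add: xs)
  then obtain as b bs where "[] @ xs = as @ b # bs" "prod_list (map f bs) \<le> prod_list (map f as)"
    "prod_list (map f (butlast as)) < f b * prod_list (map f bs)"
    using ex_balanced_prod_split_append[of "[]" xs f] pos by (metis append_Nil)
  then show ?thesis using that by simp
qed

definition shear_prod :: "('a::field bipoly \<Rightarrow> 'a bipoly) list \<Rightarrow> nat" where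
  "shear_prod \<beta>s = prod_list (map shear_degree \<beta>s)"

lemma shear_prod_simps [simp]:
  "shear_prod [] = 1" "shear_prod (\<beta> # \<beta>s) = shear_degree \<beta> * shear_prod \<beta>s"
  "shear_prod (xs @ ys) = shear_prod xs * shear_prod ys" "shear_prod (rev xs) = shear_prod xs"
  by (simp_all add: shear_prod_def prod_list.rev flip: rev_map)

lemma shear_prod_pos: "\<forall>\<beta>\<in>set \<beta>s. henon_factor \<beta> \<Longrightarrow> shear_prod \<beta>s > 0"
  unfolding shear_prod_def by (rule prod_list_map_pos) (force simp: henon_factor_def)

lemma henon_factor_triangular: "henon_factor \<beta> \<Longrightarrow> triangular \<beta>"
  by (simp add: henon_factor_def)

lemma alg_hom_swap_prod: "\<forall>\<beta>\<in>set \<beta>s. henon_factor \<beta> \<Longrightarrow> alg_hom (swap_prod \<beta>s)"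
  by (simp add: aut_alg_hom aut_swap_prod henon_factor_triangular)

lemma swap_prod_snoc:
  assumes "alg_hom (swap_prod \<beta>s)"
  shows "swap_prod (\<beta>s @ [triangular_map \<alpha> \<gamma> \<delta> p]) bX = bconst \<delta> * swap_prod \<beta>s bY + swap_prod \<beta>s [:p:]"
    and "swap_prod (\<beta>s @ [triangular_map \<alpha> \<gamma> \<delta> p]) bY = bconst \<gamma> + bconst \<alpha> * swap_prod \<beta>s bX"
proof -
  interpret alg_hom "swap_prod \<beta>s" by fact
  have "[:p, [:\<delta>:]:] = bconst \<delta> * bY + [:p:]" by (simp add: bconst_def bY_def)
  then show "swap_prod (\<beta>s @ [triangular_map \<alpha> \<gamma> \<delta> p]) bX = bconst \<delta> * swap_prod \<beta>s bY + swap_prod \<beta>s [:p:]"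
    by (simp add: swap_prod_append)
  show "swap_prod (\<beta>s @ [triangular_map \<alpha> \<gamma> \<delta> p]) bY = bconst \<gamma> + bconst \<alpha> * swap_prod \<beta>s bX"
    by (simp add: swap_prod_append hom_affine_X)
qed

lemma swap_prod_X_lead_form:
  assumes "\<forall>\<beta>\<in>set \<beta>s. henon_factor \<beta>"
  shows "x_dominant (swap_prod \<beta>s bX) \<and> tdeg (swap_prod \<beta>s bX) = shear_prod \<beta>s
    \<and> tdeg (swap_prod \<beta>s bY) \<le> shear_prod \<beta>s"
  using assms
proof (induction \<beta>s rule: rev_induct)
  case (snoc \<beta> \<beta>s)
  define \<sigma> where "\<sigma> = swap_prod \<beta>s"
  define d where "d = shear_prod \<beta>s"
  have henon: "henon_factor \<beta>" "\<forall>\<beta>\<in>set \<beta>s. henon_factor \<beta>" using snoc.prems by auto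
  have IH: "x_dominant (\<sigma> bX)" "tdeg (\<sigma> bX) = d" "tdeg (\<sigma> bY) \<le> d"
    using snoc.IH henon(2) by (auto simp: \<sigma>_def d_def)
  have "d > 0" using shear_prod_pos[OF henon(2)] by (simp add: d_def)
  have hom: "alg_hom \<sigma>" unfolding \<sigma>_def by (rule alg_hom_swap_prod[OF henon(2)])
  obtain \<alpha> \<gamma> \<delta> p where nz: "\<alpha> \<noteq> 0" "\<delta> \<noteq> 0" and \<beta>: "\<beta> = triangular_map \<alpha> \<gamma> \<delta> p"
    using henon(1) by (auto simp: henon_factor_def triangular_def)
  have "degree p \<ge> 2" using henon(1) by (simp add: henon_factor_def \<beta>)
  then have "d < degree p * d" "p \<noteq> 0" using \<open>d > 0\<close> by auto
  have p: "tdeg (\<sigma> [:p:]) = degree p * d" "x_dominant (\<sigma> [:p:])"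
    using hom_const_poly_lead_form[OF hom] x_dominant_hom_const_poly[OF hom] IH \<open>d > 0\<close> \<open>p \<noteq> 0\<close> by simp_all
  have less: "tdeg (bconst \<delta> * \<sigma> bY) < tdeg (\<sigma> [:p:])"
    using p(1) le_less_trans[OF IH(3) \<open>d < degree p * d\<close>] nz by (simp add: tdeg_scale)
  have "tdeg (bconst \<alpha> * \<sigma> bX) = d" using IH(2) nz by (simp add: tdeg_scale)
  then have "tdeg (bconst \<gamma> + bconst \<alpha> * \<sigma> bX) = d"
    using tdeg_add_eq_right(1)[of "bconst \<gamma>" "bconst \<alpha> * \<sigma> bX"] \<open>d > 0\<close> by simp
  then show ?case
    using x_dominant_add_right[OF p(2) less] tdeg_add_eq_right(1)[OF less] p(1) \<open>d < degree p * d\<close>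
    by (simp add: \<beta> swap_prod_snoc[OF hom[unfolded \<sigma>_def]] mult.commute flip: \<sigma>_def d_def)
qed (simp add: x_dominant_X)

lemma swap_prod_snoc_Y_lead_form:
  assumes \<beta>s: "\<forall>\<beta>\<in>set \<beta>s. henon_factor \<beta>" and "triangular \<beta>"
  shows "x_dominant (swap_prod (\<beta>s @ [\<beta>]) bY)" "tdeg (swap_prod (\<beta>s @ [\<beta>]) bY) = shear_prod \<beta>s"
proof -
  obtain \<alpha> \<gamma> \<delta> p where "\<alpha> \<noteq> 0" and \<beta>: "\<beta> = triangular_map \<alpha> \<gamma> \<delta> p"
    using assms(2) by (auto simp: triangular_def)
  have "tdeg (bconst \<gamma>) < tdeg (bconst \<alpha> * swap_prod \<beta>s bX)"
    using swap_prod_X_lead_form[OF \<beta>s] shear_prod_pos[OF \<beta>s] \<open>\<alpha> \<noteq> 0\<close> by (simp add: tdeg_scale)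
  then show "x_dominant (swap_prod (\<beta>s @ [\<beta>]) bY)" "tdeg (swap_prod (\<beta>s @ [\<beta>]) bY) = shear_prod \<beta>s"
    unfolding \<beta> swap_prod_snoc[OF alg_hom_swap_prod[OF \<beta>s]]
    using swap_prod_X_lead_form[OF \<beta>s] \<open>\<alpha> \<noteq> 0\<close>
    by (simp_all add: x_dominant_add_right x_dominant_scale tdeg_add_eq_right tdeg_scale)
qed

lemma tdeg_swap_prod_Y:
  assumes "\<forall>\<beta>\<in>set \<beta>s. henon_factor \<beta>"
  shows "tdeg (swap_prod \<beta>s bY) = shear_prod (butlast \<beta>s)"
proof (cases \<beta>s rule: rev_cases)
  case (snoc \<beta>s' \<beta>)
  then show ?thesis
    using assms swap_prod_snoc_Y_lead_form(2)[of \<beta>s' \<beta>] by (simp add: henon_factor_triangular)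
qed simp

lemma henon_factor_inv:
  assumes "henon_factor \<beta>"
  shows "henon_factor (inv \<beta>)" "shear_degree (inv \<beta>) = shear_degree \<beta>"
proof -
  obtain \<alpha> \<gamma> \<delta> p where "\<alpha> \<noteq> 0" "\<delta> \<noteq> 0" "\<beta> = triangular_map \<alpha> \<gamma> \<delta> p"
    using assms by (auto simp: henon_factor_def triangular_def)
  then show "shear_degree (inv \<beta>) = shear_degree \<beta>"
    by (simp add: triangular_map_inverse degree_pcompose)
  then show "henon_factor (inv \<beta>)"
    using assms by (simp add: henon_factor_def triangular_inv)
qed

lemma inv_swap_prod:
  assumes "\<forall>\<beta>\<in>set \<beta>s. triangular \<beta>"
  shows "inv (swap_prod \<beta>s) = bswap \<circ> swap_prod (rev (map inv \<beta>s)) \<circ> bswap"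
  using assms
proof (induction \<beta>s)
  case Nil
  then show ?case by (simp add: bswap_comp_bswap)
next
  case (Cons \<beta> \<beta>s)
  have bij: "bij \<beta>" "bij (bswap :: 'a bipoly \<Rightarrow> _)" "bij (swap_prod \<beta>s)"
    using Cons.prems aut_triangular[of \<beta>] aut_swap_prod[of \<beta>s] aut_bswap by (auto simp: is_K_algebra_aut_iff)
  have "inv (swap_prod (\<beta> # \<beta>s)) = inv (swap_prod \<beta>s) \<circ> bswap \<circ> inv \<beta>"
    using bij by (simp add: o_inv_distrib bij_comp inv_bswap comp_assoc)
  also have "\<dots> = bswap \<circ> swap_prod (rev (map inv \<beta>s)) \<circ> inv \<beta>"
    using Cons by (simp add: fun_eq_iff)
  also have "\<dots> = bswap \<circ> swap_prod (rev (map inv (\<beta> # \<beta>s))) \<circ> bswap"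
    by (simp add: swap_prod_append comp_assoc bswap_comp_bswap)
  finally show ?case .
qed

lemma inv_swap_prod_lead_forms:
  assumes \<beta>: "henon_factor \<beta>" and \<beta>s: "\<forall>\<beta>\<in>set \<beta>s. henon_factor \<beta>"
  defines "\<tau> \<equiv> inv (swap_prod (\<beta> # \<beta>s))"
  shows "x_dominant (bswap (\<tau> bX))" "tdeg (\<tau> bX) = shear_prod \<beta>s"
    and "x_dominant (bswap (\<tau> bY))" "tdeg (\<tau> bY) = shear_prod (\<beta> # \<beta>s)"
proof -
  define \<gamma>s where "\<gamma>s = rev (map inv \<beta>s)"
  have \<tau>: "\<tau> f = bswap (swap_prod (\<gamma>s @ [inv \<beta>]) (bswap f))" for f
    using inv_swap_prod[of "\<beta> # \<beta>s"] \<beta> \<beta>s by (simp add: \<tau>_def \<gamma>s_def henon_factor_triangular)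
  have henon: "henon_factor (inv \<beta>)" "\<forall>\<gamma>\<in>set \<gamma>s. henon_factor \<gamma>"
    using \<beta> \<beta>s henon_factor_inv(1) by (auto simp: \<gamma>s_def)
  have "shear_prod (map inv \<beta>s) = shear_prod \<beta>s"
    using \<beta>s by (induction \<beta>s) (simp_all add: henon_factor_inv)
  then have prod: "shear_prod \<gamma>s = shear_prod \<beta>s" "shear_prod (\<gamma>s @ [inv \<beta>]) = shear_prod (\<beta> # \<beta>s)"
    using \<beta> by (simp_all add: \<gamma>s_def henon_factor_inv mult.commute)
  note Y = swap_prod_snoc_Y_lead_form[OF henon(2) henon_factor_triangular[OF henon(1)]]
  show "x_dominant (bswap (\<tau> bX))" "tdeg (\<tau> bX) = shear_prod \<beta>s"
    using Y prod by (simp_all add: \<tau>)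
  have "x_dominant (swap_prod (\<gamma>s @ [inv \<beta>]) bX) \<and> tdeg (swap_prod (\<gamma>s @ [inv \<beta>]) bX) = shear_prod (\<beta> # \<beta>s)"
    using swap_prod_X_lead_form[of "\<gamma>s @ [inv \<beta>]"] henon prod by auto
  then show "x_dominant (bswap (\<tau> bY))" "tdeg (\<tau> bY) = shear_prod (\<beta> # \<beta>s)"
    by (simp_all add: \<tau>)
qed

section \<open>Fixed points of compositions of generalised Henon maps\<close>

text \<open>Dividing by \<open>f\<close>, which is monic in \<open>y\<close>, makes the cofactor of \<open>g\<close> of \<open>y\<close>-degree less than the
  order of its leading form at \<open>u = 0\<close>.\<close>
lemma coprime_lead_forms_imp_not_unit_ideal:
  fixes f g :: "'a::field bipoly"
  assumes f: "lead_form f = monom c (tdeg f)" "c \<noteq> 0" "tdeg f > 0"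
    and g: "coeff (lead_form g) 0 \<noteq> 0" "tdeg g > 0"
  shows "u * g + v * f \<noteq> 1"
proof
  assume eq: "u * g + v * f = 1"
  have nz: "f \<noteq> 0" "g \<noteq> 0" using f(3) g(2) by (auto simp: tdeg_def)
  have "lead_coeff f dvd 1"
    using lead_coeff_of_lead_form_monom[OF f(1,2)] f(2) by (simp add: is_unit_const_poly_iff dvd_field_iff)
  then obtain q r where qr: "u = f * q + r" and "r = 0 \<or> degree r < degree f"
    by (rule ex_division_unit_lead_coeff)
  define s where "s = v + q * g"
  have one: "r * g + s * f = 1" using eq by (simp add: qr s_def algebra_simps)
  have "r \<noteq> 0"
  proof
    assume "r = 0"
    then have "s * f = 1" using one by simp
    then have "tdeg s + tdeg f = tdeg (1 :: 'a bipoly)"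
      using nz by (metis tdeg_mult mult_zero_left zero_neq_one)
    then show False using f(3) tdeg_const[of "1 :: 'a"] by simp
  qed
  have "- (r * g) + 1 = s * f" using one by (simp add: algebra_simps)
  moreover have "tdeg (1 :: 'a bipoly) < tdeg (- (r * g))"
    using tdeg_const[of "1 :: 'a"] tdeg_mult[OF \<open>r \<noteq> 0\<close> nz(2)] g(2) by (simp add: tdeg_def)
  ultimately have "lead_form (s * f) = lead_form (- (r * g))"
    using tdeg_add_eq_right(2)[of 1 "- (r * g)"] by (simp add: add.commute)
  also have "\<dots> = - (lead_form r * lead_form g)"
    by (simp add: lead_form_def lead_coeff_mult lead_coeff_minus)
  finally have "lead_form r * lead_form g = - (lead_form s * monom c (tdeg f))"
    by (simp add: lead_form_mult f(1))
  also have "monom c (tdeg f) = smult c (monom 1 (tdeg f))" by (simp add: smult_monom)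
  also have "- (lead_form s * \<dots>) = monom 1 (tdeg f) * smult (- c) (lead_form s)" by (simp add: mult.commute)
  finally have "monom 1 (tdeg f) dvd lead_form r * lead_form g" by (rule dvdI)
  then have "tdeg f \<le> degree (lead_form r)"
    using \<open>r \<noteq> 0\<close> g(1) by (intro le_degree_of_monom_dvd_mult) simp_all
  also have "\<dots> \<le> degree r" by (rule degree_lead_form_le)
  finally show False
    using \<open>r = 0 \<or> degree r < degree f\<close> \<open>r \<noteq> 0\<close> lead_coeff_of_lead_form_monom(1)[OF f(1,2)] by simp
qed

lemma balanced_henon_equations_not_unit_ideal:
  assumes xs: "\<forall>\<beta>\<in>set xs. henon_factor \<beta>" and \<beta>: "henon_factor \<beta>" and ys: "\<forall>\<beta>\<in>set ys. henon_factor \<beta>"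
    and balanced: "shear_prod ys \<le> shear_prod xs" "shear_prod (butlast xs) < shear_prod (\<beta> # ys)"
  defines "\<sigma> \<equiv> swap_prod xs" and "\<tau> \<equiv> inv (swap_prod (\<beta> # ys))"
  shows "u * (\<sigma> bX - \<tau> bX) + v * (\<sigma> bY - \<tau> bY) \<noteq> 1"
proof -
  note \<sigma>_X = swap_prod_X_lead_form[OF xs, folded \<sigma>_def]
  note \<tau> = inv_swap_prod_lead_forms[OF \<beta> ys, folded \<tau>_def]
  obtain c where c: "c \<noteq> 0" "lead_form (\<tau> bY) = monom c (tdeg (\<tau> bY))"
    using lead_form_of_x_dominant_bswap[OF \<tau>(3)] .
  have "tdeg (\<sigma> bY) < tdeg (- \<tau> bY)"
    using balanced(2) tdeg_swap_prod_Y[OF xs] \<tau>(4) by (simp add: \<sigma>_def tdeg_def)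
  note Y = tdeg_add_eq_right[OF this, simplified]
  have tdeg_Y: "tdeg (\<sigma> bY - \<tau> bY) = shear_prod (\<beta> # ys)"
    unfolding Y(1) using \<tau>(4) by (simp add: tdeg_def)
  have lead_Y: "lead_form (\<sigma> bY - \<tau> bY) = monom (- c) (tdeg (\<sigma> bY - \<tau> bY))"
    unfolding tdeg_Y Y(2) using c(2) \<tau>(4) by (simp add: lead_form_def minus_monom)
  define d where "d = shear_prod xs"
  have "d > 0" using shear_prod_pos[OF xs] by (simp add: d_def)
  obtain a where a: "a \<noteq> 0" "coeff (blowup (\<sigma> bX)) d = [:a:]"
    using \<sigma>_X by (auto simp: x_dominant_def lead_form_def tdeg_def d_def)
  obtain b where b: "lead_form (\<tau> bX) = monom b (tdeg (\<tau> bX))"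
    using lead_form_of_x_dominant_bswap[OF \<tau>(1)] .
  have "tdeg (\<tau> bX) \<le> d" using balanced(1) \<tau>(2) by (simp add: d_def)
  then have "coeff (coeff (blowup (\<tau> bX)) d) 0 = 0"
    using b \<open>d > 0\<close> by (cases "tdeg (\<tau> bX) = d") (auto simp: tdeg_def lead_form_def coeff_eq_0)
  then have top: "coeff (coeff (blowup (\<sigma> bX - \<tau> bX)) d) 0 \<noteq> 0" using a by simp
  then have "d \<le> tdeg (\<sigma> bX - \<tau> bX)" unfolding tdeg_def by (intro le_degree) auto
  moreover have "tdeg (\<sigma> bX - \<tau> bX) \<le> d"
    using \<sigma>_X \<open>tdeg (\<tau> bX) \<le> d\<close> by (intro tdeg_diff_le) (simp_all add: d_def)
  ultimately have tdeg_X: "tdeg (\<sigma> bX - \<tau> bX) = d" by simp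
  then have lead_X: "coeff (lead_form (\<sigma> bX - \<tau> bX)) 0 \<noteq> 0"
    using top by (simp add: lead_form_def tdeg_def)
  show ?thesis
    by (rule coprime_lead_forms_imp_not_unit_ideal[OF lead_Y _ _ lead_X])
       (use c \<open>d > 0\<close> tdeg_X tdeg_Y shear_prod_pos[of "\<beta> # ys"] \<beta> ys in simp_all)
qed

text \<open>The fixed points of \<open>\<sigma> \<circ> \<rho>\<close> are cut out by \<open>\<sigma> = \<rho>\<inverse>\<close>. When the two sides have balanced degrees, the
  leading forms of these equations are coprime.\<close>
lemma simple_not_commute_henon:
  fixes D :: "'a::field bipoly \<Rightarrow> 'a bipoly"
  assumes D: "simple_derivation D" and "henon_word \<beta>s"
  shows "swap_prod \<beta>s \<circ> D \<noteq> D \<circ> swap_prod \<beta>s"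
proof
  assume comm: "swap_prod \<beta>s \<circ> D = D \<circ> swap_prod \<beta>s"
  have "\<beta>s \<noteq> []" "\<forall>\<beta>\<in>set \<beta>s. shear_degree \<beta> \<ge> 2"
    using assms(2) by (auto simp: henon_word_def henon_factor_def)
  then obtain xs \<beta> ys where \<beta>s: "\<beta>s = xs @ \<beta> # ys" and balanced: "shear_prod ys \<le> shear_prod xs"
      "shear_prod (butlast xs) < shear_degree \<beta> * shear_prod ys"
    by (rule ex_balanced_prod_split[where f = shear_degree, folded shear_prod_def])
  have henon: "\<forall>\<beta>\<in>set xs. henon_factor \<beta>" "henon_factor \<beta>" "\<forall>\<beta>\<in>set ys. henon_factor \<beta>"
    using assms(2) by (auto simp: \<beta>s henon_word_def)
  define \<sigma> where "\<sigma> = swap_prod xs"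
  define \<rho> where "\<rho> = swap_prod (\<beta> # ys)"
  have \<rho>: "is_K_algebra_aut \<rho>"
    unfolding \<rho>_def using henon by (intro aut_swap_prod) (simp add: henon_factor_triangular)
  note inv = aut_inv_apply_left[OF \<rho>] aut_inv_apply_right[OF \<rho>]
  define I where "I = {u * (\<sigma> bX - inv \<rho> bX) + v * (\<sigma> bY - inv \<rho> bY) | u v. True}"
  have "1 \<notin> I"
    using balanced_henon_equations_not_unit_ideal[OF henon balanced(1)] balanced(2)
    unfolding I_def \<sigma>_def \<rho>_def by fastforce
  have "tdeg (\<sigma> bY) \<noteq> tdeg (inv \<rho> bY)"
    using tdeg_swap_prod_Y[OF henon(1)] inv_swap_prod_lead_forms(4)[OF henon(2,3)] balanced(2)
    by (simp add: \<sigma>_def \<rho>_def)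
  then have "\<sigma> \<noteq> inv \<rho>" by auto
  have "\<sigma> (\<rho> (D f)) = D (\<sigma> (\<rho> f))" for f
    using fun_cong[OF comm, of f] by (simp add: \<beta>s \<sigma>_def \<rho>_def swap_prod_append)
  then have "D \<circ> \<sigma> = \<sigma> \<circ> (\<rho> \<circ> D \<circ> inv \<rho>)" "D \<circ> inv \<rho> = inv \<rho> \<circ> (\<rho> \<circ> D \<circ> inv \<rho>)"
    by (simp_all add: fun_eq_iff inv)
  moreover have "\<sigma> bX - inv \<rho> bX \<in> I" "\<sigma> bY - inv \<rho> bY \<in> I"
    unfolding I_def by (force intro: exI[of _ 0] exI[of _ 1])+
  ultimately have "1 \<in> I"
    using simple_coincidence_ideal[OF D _ _ \<open>\<sigma> \<noteq> inv \<rho>\<close>] is_ideal_two_generators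
      alg_hom_swap_prod[OF henon(1)] aut_alg_hom[OF aut_inv[OF \<rho>]] unfolding I_def \<sigma>_def by blast
  then show False using \<open>1 \<notin> I\<close> by blast
qed

theorem theorem1p1:
  fixes D :: "'a::{alg_closed_field, field_char_0} bipoly \<Rightarrow> 'a bipoly"
  assumes "simple_derivation D"
  shows "Aut_der D = {id}"
proof
  show "{id} \<subseteq> Aut_der D" by (simp add: Aut_der_def aut_id)
  show "Aut_der D \<subseteq> {id}"
  proof
    fix \<rho> assume "\<rho> \<in> Aut_der D"
    then have \<rho>: "is_K_algebra_aut \<rho>" "\<rho> \<circ> D = D \<circ> \<rho>" by (auto simp: Aut_der_def)
    obtain \<sigma> \<kappa> where \<kappa>: "is_K_algebra_aut \<kappa>" "\<kappa> \<circ> \<sigma> = \<rho> \<circ> \<kappa>"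
      and \<sigma>: "triangular \<sigma> \<or> (\<exists>\<beta>s. henon_word \<beta>s \<and> \<sigma> = swap_prod \<beta>s)"
      using aut_conjugate_triangular_or_henon[OF \<rho>(1)] by (metis conjugate_def)
    have bij: "bij \<kappa>" using \<kappa>(1) by (simp add: is_K_algebra_aut_iff)
    note E = simple_conj[OF assms \<kappa>(1)] and comm = commute_conj[OF bij \<kappa>(2) \<rho>(2)]
    have "triangular \<sigma>" using \<sigma> simple_not_commute_henon[OF E] comm by blast
    then have "\<sigma> = id" using simple_triangular_eq_id[OF E _ comm] by blast
    then have "\<rho> f = f" for f
      using fun_cong[OF \<kappa>(2), of "inv \<kappa> f"] by (simp add: aut_inv_apply_right[OF \<kappa>(1)])
    then show "\<rho> \<in> {id}" by (simp add: fun_eq_iff)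
  qed
qed

end
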